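(* Let $\tau\in\mathbb{C}$ with $\mathrm{Im}\,\tau>0$. Put $\Omega=\begin{pmatrix}\tau & 0\\ 0&\tau\end{pmatrix}$, $L_\Omega=\mathbb{Z}^{(1,2)}\Omega+\mathbb{Z}^{(1,2)}\subset\mathbb{C}^2$ and $A_\Omega=\mathbb{C}^2/L_\Omega$. Let $H_\tau:\mathbb{C}^2\times\mathbb{C}^2\to\mathbb{C}$ be the Hermitian form $$H_\tau((z_1,z_2),(w_1,w_2)):=\frac{1}{\mathrm{Im}\,\tau}\,(z_1\overline{w}_1+z_2\overline{w}_2),$$ and let $\chi_\tau$ be a semi-character of $L_\Omega$ with respect to $E_\tau=\mathrm{Im}\,H_\tau$. Then: (i) $H_\tau$ is a positive definite Riemann form for $A_\Omega$. (ii) The line bundle $L(H_\tau,\chi_\tau)$ is an ample line bundle over $A_\Omega$, and hence for every $n\ge 3$ the global sections of $L(H_\tau,\chi_\tau)^{\otimes n}$ give an embedding of $A_\Omega$ into a projective space. (iii) $\dim H^0(A_\Omega,L(H_\tau,\chi_\tau))=1.$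
   Context: $\mathbb{Z}^{(1,2)}$ denotes integer row vectors of length 2, and $\mathbb{C}^2$ consists of row vectors. The rows of $\Omega$ together with $(1,0),(0,1)$ form a $\mathbb{Z}$-basis of $L_\Omega$, which is a lattice of rank 4 in $\mathbb{C}^2$. Hermitian forms are $\mathbb{C}$-linear in the first variable and antilinear in the second. For a lattice $L\subset\mathbb{C}^2$ and $A=\mathbb{C}^2/L$, a Riemann form for $A$ is a nondegenerate Hermitian form $H$ on $\mathbb{C}^2$ whose imaginary part $E=\mathrm{Im}\,H$ is integer valued on $L\times L$. Let $T=\{t\in\mathbb{C}: |t|=1\}$. A semi-character of $L$ with respect to $E$ is a map $\chi:L\to T$ with $\chi(\alpha+\beta)=\chi(\alpha)\chi(\beta)\exp\{i\pi E(\alpha,\beta)\}$ for all $\alpha,\beta\in L$. Given $H$ and $\chi$, put $J_{H,\chi}(\alpha,z)=\chi(\alpha)\exp\{\pi H(z,\alpha)+\frac{\pi}{2}H(\alpha,\alpha)\}$ for $\alpha\in L$, $z\in\mathbb{C}^2$. $L(H,\chi)$ denotes the holomorphic line bundle over $A$ obtained as the quotient of $\mathbb{C}^2\times\mathbb{C}$ by the action of $L$ given by $\alpha\cdot(z,\xi)=(z+\alpha,J_{H,\chi}(\alpha,z)\xi)$. Its space of global sections $H^0(A,L(H,\chi))$ is identified with the space of holomorphic functions $\theta$ on $\mathbb{C}^2$ such that $\theta(z+\alpha)=J_{H,\chi}(\alpha,z)\theta(z)$ for all $\alpha\in L$, $z\in\mathbb{C}^2$. "Give an embedding" means that the map to projective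 space defined by a basis of the space of global sections is well defined and embeds $A_\Omega$ as a closed complex submanifold. *)

theory Defs
  imports "HOL-Analysis.Analysis" "HOL-Library.Function_Algebras"
begin

definition has_complex_derivative ::
    "(complex ^ 2 \<Rightarrow> complex) \<Rightarrow> (complex ^ 2 \<Rightarrow> complex) \<Rightarrow> complex ^ 2 \<Rightarrow> bool" where
  "has_complex_derivative f D z \<longleftrightarrow>
     (f has_derivative D) (at z) \<and> (\<forall>c v. D (c *s v) = c * D v)"

definition entire2 :: "(complex ^ 2 \<Rightarrow> complex) \<Rightarrow> bool" where
  "entire2 f \<longleftrightarrow> (\<forall>z. \<exists>D. has_complex_derivative f D z)"

global_interpretation cfun: vector_space
    "\<lambda>(c :: complex) (f :: complex ^ 2 \<Rightarrow> complex) z. c * f z"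
  by unfold_locales (auto simp: fun_eq_iff algebra_simps)

definition int_rows :: "(complex ^ 2) set" where
  "int_rows = {a. \<forall>i. a $ i \<in> \<int>}"

definition period_lattice :: "complex ^ 2 ^ 2 \<Rightarrow> (complex ^ 2) set" where
  "period_lattice \<Omega> = {a v* \<Omega> + b | a b. a \<in> int_rows \<and> b \<in> int_rows}"

definition lattice_rel :: "(complex ^ 2) set \<Rightarrow> ((complex ^ 2) \<times> (complex ^ 2)) set" where
  "lattice_rel L = {(z, w). w - z \<in> L}"

definition torus :: "(complex ^ 2) set \<Rightarrow> (complex ^ 2) set set" where
  "torus L = UNIV // lattice_rel L"

definition torus_proj :: "(complex ^ 2) set \<Rightarrow> complex ^ 2 \<Rightarrow> (complex ^ 2) set" where
  "torus_proj L z = lattice_rel L `` {z}"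

definition quotient_topology :: "'a topology \<Rightarrow> ('a \<Rightarrow> 'b) \<Rightarrow> 'b topology" where
  "quotient_topology X q =
     topology (\<lambda>U. U \<subseteq> q ` topspace X \<and> openin X {x \<in> topspace X. q x \<in> U})"

lemma openin_quotient_topology:
  "openin (quotient_topology X q) U \<longleftrightarrow>
     U \<subseteq> q ` topspace X \<and> openin X {x \<in> topspace X. q x \<in> U}"
proof -
  have "istopology (\<lambda>U. U \<subseteq> q ` topspace X \<and> openin X {x \<in> topspace X. q x \<in> U})"
    unfolding istopology_def
  proof (intro conjI allI impI)
    fix S T assume "S \<subseteq> q ` topspace X \<and> openin X {x \<in> topspace X. q x \<in> S}"
      "T \<subseteq> q ` topspace X \<and> openin X {x \<in> topspace X. q x \<in> T}"
    moreover have "{x \<in> topspace X. q x \<in> S \<inter> T} =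
        {x \<in> topspace X. q x \<in> S} \<inter> {x \<in> topspace X. q x \<in> T}" by auto
    ultimately show "S \<inter> T \<subseteq> q ` topspace X" "openin X {x \<in> topspace X. q x \<in> S \<inter> T}"
      by auto
  next
    fix \<K> assume K: "\<forall>S\<in>\<K>. S \<subseteq> q ` topspace X \<and> openin X {x \<in> topspace X. q x \<in> S}"
    have "{x \<in> topspace X. q x \<in> \<Union>\<K>} = (\<Union>S\<in>\<K>. {x \<in> topspace X. q x \<in> S})" by auto
    with K show "openin X {x \<in> topspace X. q x \<in> \<Union>\<K>}" by auto
    show "\<Union>\<K> \<subseteq> q ` topspace X" using K by blast
  qed
  then show ?thesis by (simp add: quotient_topology_def topology_inverse')
qed

definition torus_topology :: "(complex ^ 2) set \<Rightarrow> (complex ^ 2) set topology" where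
  "torus_topology L = quotient_topology euclidean (torus_proj L)"

definition hermitian_form :: "(complex ^ 2 \<Rightarrow> complex ^ 2 \<Rightarrow> complex) \<Rightarrow> bool" where
  "hermitian_form H \<longleftrightarrow>
     (\<forall>z z' w. H (z + z') w = H z w + H z' w) \<and>
     (\<forall>c z w. H (c *s z) w = c * H z w) \<and>
     (\<forall>z w. H w z = cnj (H z w))"

definition nondegenerate :: "(complex ^ 2 \<Rightarrow> complex ^ 2 \<Rightarrow> complex) \<Rightarrow> bool" where
  "nondegenerate H \<longleftrightarrow> (\<forall>z. (\<forall>w. H z w = 0) \<longrightarrow> z = 0)"

definition positive_definite :: "(complex ^ 2 \<Rightarrow> complex ^ 2 \<Rightarrow> complex) \<Rightarrow> bool" where
  "positive_definite H \<longleftrightarrow> (\<forall>z. z \<noteq> 0 \<longrightarrow> H z z \<in> \<real> \<and> Re (H z z) > 0)"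

definition riemann_form ::
    "(complex ^ 2) set \<Rightarrow> (complex ^ 2 \<Rightarrow> complex ^ 2 \<Rightarrow> complex) \<Rightarrow> bool" where
  "riemann_form L H \<longleftrightarrow>
     hermitian_form H \<and> nondegenerate H \<and> (\<forall>\<alpha>\<in>L. \<forall>\<beta>\<in>L. Im (H \<alpha> \<beta>) \<in> \<int>)"

text \<open>Only the values of \<open>ch\<close> on \<open>L\<close> matter, here and in everything below.\<close>

definition semi_character ::
    "(complex ^ 2) set \<Rightarrow> (complex ^ 2 \<Rightarrow> complex ^ 2 \<Rightarrow> real) \<Rightarrow> (complex ^ 2 \<Rightarrow> complex) \<Rightarrow> bool" where
  "semi_character L E ch \<longleftrightarrow>
     (\<forall>\<alpha>\<in>L. norm (ch \<alpha>) = 1) \<and>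
     (\<forall>\<alpha>\<in>L. \<forall>\<beta>\<in>L. ch (\<alpha> + \<beta>) = ch \<alpha> * ch \<beta> * exp (\<i> * of_real pi * of_real (E \<alpha> \<beta>)))"

definition automorphy_factor ::
    "(complex ^ 2 \<Rightarrow> complex ^ 2 \<Rightarrow> complex) \<Rightarrow> (complex ^ 2 \<Rightarrow> complex) \<Rightarrow>
     complex ^ 2 \<Rightarrow> complex ^ 2 \<Rightarrow> complex" where
  "automorphy_factor H ch \<alpha> z =
     ch \<alpha> * exp (of_real pi * H z \<alpha> + of_real pi / 2 * H \<alpha> \<alpha>)"

definition action_rel ::
    "(complex ^ 2) set \<Rightarrow> (complex ^ 2 \<Rightarrow> complex ^ 2 \<Rightarrow> complex) \<Rightarrow>
     (((complex ^ 2) \<times> complex) \<times> ((complex ^ 2) \<times> complex)) set" where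
  "action_rel L J = {((z, \<xi>), (z + \<alpha>, J \<alpha> z * \<xi>)) | z \<xi> \<alpha>. \<alpha> \<in> L}"

type_synonym bundle_space = "((complex ^ 2) \<times> complex) set set"

definition quotient_bundle ::
    "(complex ^ 2) set \<Rightarrow> (complex ^ 2 \<Rightarrow> complex ^ 2 \<Rightarrow> complex) \<Rightarrow> bundle_space" where
  "quotient_bundle L J = UNIV // action_rel L J"

definition line_bundle ::
    "(complex ^ 2) set \<Rightarrow> (complex ^ 2 \<Rightarrow> complex ^ 2 \<Rightarrow> complex) \<Rightarrow> (complex ^ 2 \<Rightarrow> complex) \<Rightarrow>
     bundle_space" where
  "line_bundle L H ch = quotient_bundle L (automorphy_factor H ch)"

text \<open>
  A point of such a bundle lying over the coset \<open>a \<in> torus L\<close> is an orbit, that is, the graph of a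
  function \<open>a \<rightarrow> \<complex>\<close>; so the fibre over \<open>a\<close> is a one-dimensional space of functions on \<open>a\<close> under
  the pointwise operations, and the pure tensors \<open>v\<^sub>1 \<otimes> \<dots> \<otimes> v\<^sub>n\<close> of its \<open>n\<close>-th tensor
  power are realised as pointwise products. As the fibre is a line, the tensor power consists of
  the multiples \<open>c \<cdot> v\<^sup>n\<close>.
\<close>

definition tensor_power :: "bundle_space \<Rightarrow> nat \<Rightarrow> bundle_space" where
  "tensor_power B n = {(\<lambda>(z, \<xi>). (z, c * \<xi> ^ n)) ` b | b c. b \<in> B}"

lemma action_rel_Image:
  "action_rel L J `` {(z, \<xi>)} = {(z + \<alpha>, J \<alpha> z * \<xi>) | \<alpha>. \<alpha> \<in> L}"
  by (auto simp: action_rel_def)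

lemma tensor_power_quotient_bundle:
  "tensor_power (quotient_bundle L J) n = quotient_bundle L (\<lambda>\<alpha> z. J \<alpha> z ^ n)"
proof -
  have *: "(\<lambda>(z, \<xi>). (z, c * \<xi> ^ n)) ` (action_rel L J `` {(z, \<xi>)}) =
      action_rel L (\<lambda>\<alpha> z. J \<alpha> z ^ n) `` {(z, c * \<xi> ^ n)}" for c z \<xi>
    unfolding action_rel_Image by (force simp: power_mult_distrib algebra_simps)
  show ?thesis
  proof (intro equalityI subsetI)
    fix x assume "x \<in> tensor_power (quotient_bundle L J) n"
    then show "x \<in> quotient_bundle L (\<lambda>\<alpha> z. J \<alpha> z ^ n)"
      by (auto simp: tensor_power_def quotient_bundle_def quotient_def *) blast
  next
    fix x assume "x \<in> quotient_bundle L (\<lambda>\<alpha> z. J \<alpha> z ^ n)"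
    then obtain z \<xi> where "x = action_rel L (\<lambda>\<alpha> z. J \<alpha> z ^ n) `` {(z, \<xi>)}"
      by (auto simp: quotient_bundle_def quotient_def)
    then have "x = (\<lambda>(z, \<eta>). (z, \<xi> * \<eta> ^ n)) ` (action_rel L J `` {(z, 1)})"
      by (simp add: *)
    then show "x \<in> tensor_power (quotient_bundle L J) n"
      by (auto simp: tensor_power_def quotient_bundle_def quotient_def)
  qed
qed

text \<open>
  A holomorphic section sends each coset \<open>a\<close> to a point of the bundle over \<open>a\<close>, which is the graph
  over \<open>a\<close> of a function. Glued together these functions form the lift \<open>\<theta>\<close> of the section to
  \<open>\<complex>\<^sup>2\<close>, and the section is identified with \<open>\<theta>\<close>; lemma \<open>global_sections_quotient_bundle\<close>
  shows that this amounts to the functional equation for \<open>\<theta>\<close>.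
\<close>

definition global_sections :: "(complex ^ 2) set \<Rightarrow> bundle_space \<Rightarrow> (complex ^ 2 \<Rightarrow> complex) set" where
  "global_sections L B = {\<theta>. entire2 \<theta> \<and> (\<forall>a \<in> torus L. (\<lambda>z. (z, \<theta> z)) ` a \<in> B)}"

lemma global_sections_quotient_bundle:
  assumes L: "0 \<in> L" and J0: "\<And>z. J 0 z = 1"
    and cocycle: "\<And>\<alpha> \<beta> z. \<alpha> \<in> L \<Longrightarrow> \<beta> \<in> L \<Longrightarrow> J (\<alpha> + \<beta>) z = J \<alpha> (z + \<beta>) * J \<beta> z"
    and uminus: "\<And>\<alpha>. \<alpha> \<in> L \<Longrightarrow> - \<alpha> \<in> L"
    and plus: "\<And>\<alpha> \<beta>. \<alpha> \<in> L \<Longrightarrow> \<beta> \<in> L \<Longrightarrow> \<alpha> + \<beta> \<in> L"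
  shows "global_sections L (quotient_bundle L J) =
    {\<theta>. entire2 \<theta> \<and> (\<forall>\<alpha>\<in>L. \<forall>z. \<theta> (z + \<alpha>) = J \<alpha> z * \<theta> z)}"
proof -
  have coset: "lattice_rel L `` {z} = {z + \<alpha> | \<alpha>. \<alpha> \<in> L}" for z
  proof -
    have "\<exists>\<alpha>. w = z + \<alpha> \<and> \<alpha> \<in> L" if "w - z \<in> L" for w
      using that by (intro exI[of _ "w - z"]) auto
    then show ?thesis by (auto simp: lattice_rel_def)
  qed
  have "(\<forall>a\<in>torus L. (\<lambda>z. (z, \<theta> z)) ` a \<in> quotient_bundle L J) \<longleftrightarrow>
      (\<forall>\<alpha>\<in>L. \<forall>z. \<theta> (z + \<alpha>) = J \<alpha> z * \<theta> z)" for \<theta>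
  proof
    assume *: "\<forall>a\<in>torus L. (\<lambda>z. (z, \<theta> z)) ` a \<in> quotient_bundle L J"
    show "\<forall>\<alpha>\<in>L. \<forall>z. \<theta> (z + \<alpha>) = J \<alpha> z * \<theta> z"
    proof (intro ballI allI)
      fix \<alpha> z assume \<alpha>: "\<alpha> \<in> L"
      have "lattice_rel L `` {z} \<in> torus L" by (auto simp: torus_def quotient_def)
      with * obtain y \<eta> where e: "(\<lambda>z. (z, \<theta> z)) ` {z + \<alpha> | \<alpha>. \<alpha> \<in> L} =
          {(y + \<alpha>, J \<alpha> y * \<eta>) | \<alpha>. \<alpha> \<in> L}"
        unfolding quotient_bundle_def quotient_def coset
        by (auto simp: action_rel_Image) 
      have "(z + 0, \<theta> (z + 0)) \<in> (\<lambda>z. (z, \<theta> z)) ` {z + \<alpha> | \<alpha>. \<alpha> \<in> L}" using L by blast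
      then obtain \<beta> where \<beta>: "\<beta> \<in> L" "z = y + \<beta>" "\<theta> z = J \<beta> y * \<eta>" unfolding e by auto
      have "(z + \<alpha>, \<theta> (z + \<alpha>)) \<in> (\<lambda>z. (z, \<theta> z)) ` {z + \<alpha> | \<alpha>. \<alpha> \<in> L}" using \<alpha> by blast
      then obtain \<gamma> where \<gamma>: "\<gamma> \<in> L" "z + \<alpha> = y + \<gamma>" "\<theta> (z + \<alpha>) = J \<gamma> y * \<eta>" unfolding e by auto
      from \<beta> \<gamma> have "\<gamma> = \<alpha> + \<beta>" by (simp add: algebra_simps)
      with \<beta> \<gamma> cocycle[OF \<alpha> \<beta>(1)] show "\<theta> (z + \<alpha>) = J \<alpha> z * \<theta> z" by simp
    qed
  next
    assume *: "\<forall>\<alpha>\<in>L. \<forall>z. \<theta> (z + \<alpha>) = J \<alpha> z * \<theta> z"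
    show "\<forall>a\<in>torus L. (\<lambda>z. (z, \<theta> z)) ` a \<in> quotient_bundle L J"
    proof
      fix a assume "a \<in> torus L"
      then obtain z where "a = {z + \<alpha> | \<alpha>. \<alpha> \<in> L}"
        by (auto simp: torus_def quotient_def coset)
      then have "(\<lambda>z. (z, \<theta> z)) ` a = action_rel L J `` {(z, \<theta> z)}"
        using * by (force simp: action_rel_Image)
      then show "(\<lambda>z. (z, \<theta> z)) ` a \<in> quotient_bundle L J"
        by (auto simp: quotient_bundle_def quotient_def)
    qed
  qed
  then show ?thesis by (simp add: global_sections_def)
qed

lemma global_sections_line_bundle:
  assumes R: "riemann_form L H" and ch: "semi_character L (\<lambda>z w. Im (H z w)) ch"
    and L0: "0 \<in> L" and plus: "\<And>\<alpha> \<beta>. \<alpha> \<in> L \<Longrightarrow> \<beta> \<in> L \<Longrightarrow> \<alpha> + \<beta> \<in> L"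
    and uminus: "\<And>\<alpha>. \<alpha> \<in> L \<Longrightarrow> - \<alpha> \<in> L"
  shows "global_sections L (line_bundle L H ch) =
    {\<theta>. entire2 \<theta> \<and> (\<forall>\<alpha>\<in>L. \<forall>z. \<theta> (z + \<alpha>) = automorphy_factor H ch \<alpha> z * \<theta> z)}"
  unfolding line_bundle_def
proof (rule global_sections_quotient_bundle)
  have add1: "H (z + z') w = H z w + H z' w" and cnj: "H w z = cnj (H z w)" for z z' w
    using R unfolding riemann_form_def hermitian_form_def by blast+
  have add2: "H w (z + z') = H w z + H w z'" for z z' w
    by (metis add1 cnj complex_cnj_add)
  have H0: "H 0 w = 0" "H w 0 = 0" for w
    using add1[of 0 0 w] add2[of w 0 0] by simp_all
  have "norm (ch 0) = 1" "ch (0 + 0) = ch 0 * ch 0 * exp (\<i> * of_real pi * of_real (Im (H 0 0)))"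
    using ch L0 unfolding semi_character_def by blast+
  then have "ch 0 = 1" by (auto simp: H0)
  then show "automorphy_factor H ch 0 z = 1" for z by (simp add: automorphy_factor_def H0)
  show "automorphy_factor H ch (\<alpha> + \<beta>) z =
      automorphy_factor H ch \<alpha> (z + \<beta>) * automorphy_factor H ch \<beta> z"
    if "\<alpha> \<in> L" "\<beta> \<in> L" for \<alpha> \<beta> z
  proof -
    obtain k where k: "Im (H \<alpha> \<beta>) = of_int k"
      using R \<open>\<alpha> \<in> L\<close> \<open>\<beta> \<in> L\<close> unfolding riemann_form_def by (metis Ints_cases)
    have "ch (\<alpha> + \<beta>) = ch \<alpha> * ch \<beta> * exp (\<i> * of_real pi * of_real (Im (H \<alpha> \<beta>)))"
      using ch that unfolding semi_character_def by blast
    also have "exp (\<i> * of_real pi * of_real (Im (H \<alpha> \<beta>))) =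
        exp (- (\<i> * of_real pi * of_real (Im (H \<alpha> \<beta>))))"
      unfolding exp_eq by (intro exI[of _ k]) (simp add: k)
    finally have c: "ch (\<alpha> + \<beta>) =
        ch \<alpha> * ch \<beta> * exp (- (\<i> * of_real pi * of_real (Im (H \<alpha> \<beta>))))" .
    have e: "- (\<i> * of_real pi * of_real (Im (H \<alpha> \<beta>))) =
        of_real pi * ((H \<beta> \<alpha> - H \<alpha> \<beta>) / 2)"
      unfolding cnj[of \<beta> \<alpha>] by (simp add: complex_eq_iff)
    show ?thesis
      unfolding automorphy_factor_def c e add1 add2
      by (simp add: exp_add[symmetric] algebra_simps) (simp add: field_simps exp_add[symmetric])
  qed
qed (use L0 plus uminus in auto)

text \<open>
  Since the dimension varies inside the statement, \<open>\<complex>\<^sup>m\<close> is modelled by the functions on \<open>nat\<close>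
  vanishing from \<open>m\<close> on; it carries the topology of pointwise convergence. The projective space
  \<open>proj_space m\<close> has dimension \<open>m - 1\<close>.
\<close>

definition cvec :: "nat \<Rightarrow> (nat \<Rightarrow> complex) set" where
  "cvec m = {v. \<forall>j\<ge>m. v j = 0}"

definition cvec_nonzero :: "nat \<Rightarrow> (nat \<Rightarrow> complex) set" where
  "cvec_nonzero m = cvec m - {\<lambda>_. 0}"

definition proj_rel :: "((nat \<Rightarrow> complex) \<times> (nat \<Rightarrow> complex)) set" where
  "proj_rel = {(v, w). \<exists>c. c \<noteq> 0 \<and> w = (\<lambda>j. c * v j)}"

definition proj_space :: "nat \<Rightarrow> (nat \<Rightarrow> complex) set set" where
  "proj_space m = cvec_nonzero m // proj_rel"

definition proj_class :: "(nat \<Rightarrow> complex) \<Rightarrow> (nat \<Rightarrow> complex) set" where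
  "proj_class v = proj_rel `` {v}"

definition proj_topology :: "nat \<Rightarrow> (nat \<Rightarrow> complex) set topology" where
  "proj_topology m = quotient_topology (top_of_set (cvec_nonzero m)) proj_class"

definition affine_domain :: "nat \<Rightarrow> nat \<Rightarrow> (nat \<Rightarrow> complex) set set" where
  "affine_domain m i = {p \<in> proj_space m. \<forall>v\<in>p. v i \<noteq> 0}"

definition affine_coord :: "nat \<Rightarrow> nat \<Rightarrow> (nat \<Rightarrow> complex) set \<Rightarrow> complex" where
  "affine_coord i j p = the_elem ((\<lambda>v. v j / v i) ` p)"

lemma affine_coord_proj_class: "affine_coord i j (proj_class v) = v j / v i"
proof -
  have "v \<in> proj_class v" by (auto simp: proj_class_def proj_rel_def intro!: exI[of _ 1])
  then have "(\<lambda>v. v j / v i) ` proj_class v = {v j / v i}"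
    by (auto simp: proj_class_def proj_rel_def)
  then show ?thesis by (simp add: affine_coord_def)
qed

text \<open>
  A closed holomorphic embedding: a topological embedding with closed image which, in the local
  coordinates given by \<open>torus_proj L\<close> on the source and by the affine charts on the target, is
  holomorphic with injective differential. The constant coordinate \<open>j = i\<close> is included for uniformity.
\<close>

definition closed_holomorphic_embedding ::
    "(complex ^ 2) set \<Rightarrow> nat \<Rightarrow> ((complex ^ 2) set \<Rightarrow> (nat \<Rightarrow> complex) set) \<Rightarrow> bool" where
  "closed_holomorphic_embedding L m \<phi> \<longleftrightarrow>
     embedding_map (torus_topology L) (proj_topology m) \<phi> \<and>
     closedin (proj_topology m) (\<phi> ` torus L) \<and>
     (\<forall>z. \<forall>i<m. \<phi> (torus_proj L z) \<in> affine_domain m i \<longrightarrow>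
        (\<exists>D. (\<forall>j<m. has_complex_derivative (\<lambda>w. affine_coord i j (\<phi> (torus_proj L w))) (D j) z) \<and>
             (\<forall>v. (\<forall>j<m. D j v = 0) \<longrightarrow> v = 0)))"

definition is_basis :: "(complex ^ 2 \<Rightarrow> complex) set \<Rightarrow> (complex ^ 2 \<Rightarrow> complex) list \<Rightarrow> bool" where
  "is_basis S bs \<longleftrightarrow> distinct bs \<and> cfun.independent (set bs) \<and> cfun.span (set bs) = S"

definition eval_list :: "(complex ^ 2 \<Rightarrow> complex) list \<Rightarrow> complex ^ 2 \<Rightarrow> nat \<Rightarrow> complex" where
  "eval_list bs z = (\<lambda>j. if j < length bs then (bs ! j) z else 0)"

text \<open>
  The existence of \<open>\<phi>\<close> expresses that the map defined by the basis is well defined on the torus: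
  the basis has no common zero and \<open>proj_class (eval_list bs z)\<close> depends only on \<open>z\<close> modulo \<open>L\<close>.
\<close>

definition sections_give_embedding :: "(complex ^ 2) set \<Rightarrow> bundle_space \<Rightarrow> bool" where
  "sections_give_embedding L B \<longleftrightarrow>
     (\<exists>bs. is_basis (global_sections L B) bs) \<and>
     (\<forall>bs. is_basis (global_sections L B) bs \<longrightarrow>
        (\<exists>\<phi>. (\<forall>z. eval_list bs z \<noteq> (\<lambda>_. 0) \<and> \<phi> (torus_proj L z) = proj_class (eval_list bs z)) \<and>
             closed_holomorphic_embedding L (length bs) \<phi>))"

text \<open>Ample: some positive tensor power is very ample.\<close>

definition ample :: "(complex ^ 2) set \<Rightarrow> bundle_space \<Rightarrow> bool" where
  "ample L B \<longleftrightarrow> (\<exists>k\<ge>1. sections_give_embedding L (tensor_power B k))"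

definition Omega_tau :: "complex \<Rightarrow> complex ^ 2 ^ 2" where
  "Omega_tau \<tau> = vector [vector [\<tau>, 0], vector [0, \<tau>]]"

definition L_tau :: "complex \<Rightarrow> (complex ^ 2) set" where
  "L_tau \<tau> = period_lattice (Omega_tau \<tau>)"

definition H_tau :: "complex \<Rightarrow> complex ^ 2 \<Rightarrow> complex ^ 2 \<Rightarrow> complex" where
  "H_tau \<tau> z w = 1 / of_real (Im \<tau>) * (z $ 1 * cnj (w $ 1) + z $ 2 * cnj (w $ 2))"

end

theory Submission
  imports Defs "HOL-Complex_Analysis.Complex_Analysis"
begin

text \<open>
  Write \<open>\<Lambda> = \<int>\<tau> + \<int>\<close>. The lattice is \<open>\<Lambda> \<times> \<Lambda>\<close>, and the form \<open>H\<^sub>\<tau>\<close> is the orthogonal sum of two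
  copies of \<open>x \<cdot> cnj y / Im \<tau>\<close>; so \<open>A\<^sub>\<Omega>\<close> is the square of an elliptic curve with its product
  polarization, and every question about sections is settled one variable at a time. The Riemann
  form is integral because \<open>Im ((m\<tau> + n) \<cdot> cnj (k\<tau> + l)) = (ml - nk) Im \<tau>\<close>.

  In one variable a section of the \<open>n\<close>-th power is an entire function with prescribed multipliers
  of degree \<open>n\<close> under the translations by \<open>1\<close> and \<open>\<tau>\<close> (\<open>theta_space\<close>). An infinite product
  gives one such function of degree \<open>1\<close> whose zeros are simple and form exactly \<open>\<Lambda>\<close>
  (\<open>sigma_theta\<close>). A theta function that vanishes at \<open>p\<close> vanishes on \<open>p + \<Lambda>\<close>, hence can be
  divided by a translate of \<open>sigma_theta\<close>, which lowers its degree by one. In degree \<open>0\<close>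
  Liouville's theorem leaves only exponentials (\<open>theta_space_degree_0\<close>). This has two
  consequences. A function of degree \<open>n\<close> is determined by its values at \<open>n + 1\<close> points that are
  incongruent modulo \<open>\<Lambda>\<close> (\<open>theta_space_eq_0\<close>), so the spaces of sections have finite dimension.
  In degree \<open>1\<close> all functions with given multipliers are proportional (\<open>theta_space_1_unique\<close>):
  subtracting a multiple of a known one moves a zero to a place where a nonzero function of that
  degree cannot have it. Applied to both slices of a section of two variables, this proves that
  \<open>H\<^sup>0\<close> is spanned by a single product \<open>\<theta>\<^sub>1(z\<^sub>1) \<theta>\<^sub>2(z\<^sub>2)\<close>.

  For the embedding, take \<open>n \<ge> 3\<close>. If \<open>\<theta>\<close> has degree \<open>1\<close>, then
  \<open>\<theta>(z + a) \<theta>(z + t)\<^sup>n\<^sup>-\<^sup>2 \<theta>(z - a - (n - 2) t)\<close> has degree \<open>n\<close> and the multipliers of \<open>\<theta>\<^sup>n\<close>, because the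
  translations add up to zero. The parameter \<open>a\<close> puts a simple zero at a chosen point, and \<open>t\<close>,
  for which only countably many values are forbidden, keeps all other zeros away from finitely
  many given points (\<open>theta_space_separation\<close>). Products of such functions in the two coordinates
  separate points and tangent vectors of the torus. Since the torus is compact and projective
  space is Hausdorff, an injective immersion given by sections is a closed embedding
  (\<open>separating_sections_embed\<close>); the criterion is phrased through the span of the chosen basis and
  hence is independent of the basis. Ampleness is the case \<open>n = 3\<close>.
\<close>

no_notation fps_nth (infixl "$" 75)

section \<open>Entire functions of one variable\<close>

lemma entire_compose:
  fixes f g :: "complex \<Rightarrow> complex"
  assumes "f holomorphic_on UNIV" "g holomorphic_on UNIV"
  shows "(\<lambda>z. f (g z)) holomorphic_on UNIV"
  using holomorphic_on_compose[OF assms(2) holomorphic_on_subset[OF assms(1)]]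
  by (simp add: o_def)

lemma entire_has_deriv:
  fixes f :: "complex \<Rightarrow> complex"
  assumes "f holomorphic_on UNIV"
  shows "(f has_field_derivative deriv f z) (at z)"
  using holomorphic_derivI[OF assms] by simp

lemma entire_translate_has_deriv:
  fixes f :: "complex \<Rightarrow> complex"
  assumes "f holomorphic_on UNIV"
  shows "((\<lambda>z. f (z + a)) has_field_derivative deriv f (z + a)) (at z)"
  using entire_has_deriv[OF assms, of "z + a"] by (simp add: DERIV_shift)

lemma entire_mult_eq_0:
  fixes f g :: "complex \<Rightarrow> complex"
  assumes f: "f holomorphic_on UNIV" and g: "g holomorphic_on UNIV"
    and fg: "\<And>z. f z * g z = 0" and a: "g a \<noteq> 0"
  shows "f z = 0"
proof -
  have "open (g -` (- {0}))"
    using holomorphic_on_imp_continuous_on[OF g] by (intro open_vimage) auto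
  then have "open {z. g z \<noteq> 0}" by (simp add: vimage_def)
  then show ?thesis
    by (rule analytic_continuation_open[where s' = UNIV and g = "\<lambda>_. 0"])
      (use f fg a in auto)
qed

text \<open>
  Off the zeros of \<open>s\<close> the quotient is \<open>f / s\<close>. At a zero \<open>a\<close> of \<open>s\<close> both functions are divided by
  \<open>z - a\<close>; simplicity of the zero makes the new denominator nonzero near \<open>a\<close>.
\<close>

lemma entire_divide:
  fixes f s :: "complex \<Rightarrow> complex"
  assumes f: "f holomorphic_on UNIV" and s: "s holomorphic_on UNIV"
    and simple: "\<And>z. s z = 0 \<Longrightarrow> deriv s z \<noteq> 0 \<and> f z = 0"
  obtains g where "g holomorphic_on UNIV" "\<And>z. f z = g z * s z"
proof
  define g where "g = (\<lambda>z. if s z = 0 then deriv f z / deriv s z else f z / s z)"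
  show "f z = g z * s z" for z using simple by (simp add: g_def)
  have "g field_differentiable at z" for z
  proof (cases "s z = 0")
    case False
    have "open (s -` (- {0}))"
      using holomorphic_on_imp_continuous_on[OF s] by (intro open_vimage) auto
    then have U: "open {z. s z \<noteq> 0}" by (simp add: vimage_def)
    have "(\<lambda>z. f z / s z) holomorphic_on {z. s z \<noteq> 0}"
      by (intro holomorphic_intros holomorphic_on_subset[OF f] holomorphic_on_subset[OF s]) auto
    then have "g holomorphic_on {z. s z \<noteq> 0}"
      by (rule holomorphic_transform) (auto simp: g_def)
    with U False show ?thesis by (auto simp: holomorphic_on_open field_differentiable_def)
  next
    case True
    define F where "F = (\<lambda>w. if w = z then deriv f z else (f w - f z) / (w - z))"
    define S where "S = (\<lambda>w. if w = z then deriv s z else (s w - s z) / (w - z))"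
    have F: "F holomorphic_on UNIV" and S: "S holomorphic_on UNIV"
      unfolding F_def S_def by (rule pole_lemma_open; use f s in auto)+
    have "open (S -` (- {0}))"
      using holomorphic_on_imp_continuous_on[OF S] by (intro open_vimage) auto
    then have U: "open {w. S w \<noteq> 0}" by (simp add: vimage_def)
    have "(\<lambda>w. F w / S w) holomorphic_on {w. S w \<noteq> 0}"
      by (intro holomorphic_intros holomorphic_on_subset[OF F] holomorphic_on_subset[OF S]) auto
    then have "g holomorphic_on {w. S w \<noteq> 0}"
      by (rule holomorphic_transform) (use True simple in \<open>auto simp: g_def F_def S_def\<close>)
    moreover have "S z \<noteq> 0" using True simple by (simp add: S_def)
    ultimately show ?thesis using U by (auto simp: holomorphic_on_open field_differentiable_def)
  qed
  then show "g holomorphic_on UNIV"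
    by (auto simp: holomorphic_on_def intro: field_differentiable_at_within)
qed

section \<open>The lattice of an elliptic curve\<close>

lemma real_coordinates:
  assumes "Im \<tau> \<noteq> 0"
  obtains x y :: real where "z = of_real x * \<tau> + of_real y"
proof
  show "z = of_real (Im z / Im \<tau>) * \<tau> + of_real (Re z - Im z / Im \<tau> * Re \<tau>)"
    using assms by (simp add: complex_eq_iff)
qed

definition lattice1 :: "complex \<Rightarrow> complex set" where
  "lattice1 \<tau> = {of_int m * \<tau> + of_int n | m n. True}"

definition parallelogram :: "complex \<Rightarrow> complex set" where
  "parallelogram \<tau> = (\<lambda>p. of_real (fst p) * \<tau> + of_real (snd p)) ` ({0..1} \<times> {0..1::real})"

lemma compact_parallelogram: "compact (parallelogram \<tau>)"
  unfolding parallelogram_def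
  by (intro compact_continuous_image compact_Times continuous_intros) auto

lemma parallelogram_reduction:
  assumes "Im \<tau> \<noteq> 0"
  obtains w l where "w \<in> parallelogram \<tau>" "l \<in> lattice1 \<tau>" "z = w + l"
proof -
  obtain x y where z: "z = of_real x * \<tau> + of_real y" using real_coordinates[OF assms] .
  have "frac x \<in> {0..1}" "frac y \<in> {0..1}" by (auto simp: frac_ge_0 frac_lt_1 less_imp_le)
  then have "of_real (frac x) * \<tau> + of_real (frac y) \<in> parallelogram \<tau>"
    unfolding parallelogram_def by force
  moreover have "of_int \<lfloor>x\<rfloor> * \<tau> + of_int \<lfloor>y\<rfloor> \<in> lattice1 \<tau>" unfolding lattice1_def by blast
  moreover have "z = (of_real (frac x) * \<tau> + of_real (frac y)) + (of_int \<lfloor>x\<rfloor> * \<tau> + of_int \<lfloor>y\<rfloor>)"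
    by (simp add: z frac_def algebra_simps)
  ultimately show thesis using that by blast
qed

lemma lattice1_closed:
  shows zero_in_lattice1: "0 \<in> lattice1 \<tau>" and one_in_lattice1: "1 \<in> lattice1 \<tau>"
    and tau_in_lattice1: "\<tau> \<in> lattice1 \<tau>"
    and add_in_lattice1: "\<And>x y. x \<in> lattice1 \<tau> \<Longrightarrow> y \<in> lattice1 \<tau> \<Longrightarrow> x + y \<in> lattice1 \<tau>"
    and uminus_in_lattice1: "\<And>x. x \<in> lattice1 \<tau> \<Longrightarrow> - x \<in> lattice1 \<tau>"
proof -
  have I: "of_int m * \<tau> + of_int n \<in> lattice1 \<tau>" for m n unfolding lattice1_def by blast
  show "0 \<in> lattice1 \<tau>" "1 \<in> lattice1 \<tau>" "\<tau> \<in> lattice1 \<tau>"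
    using I[of 0 0] I[of 0 1] I[of 1 0] by simp_all
  fix x assume "x \<in> lattice1 \<tau>"
  then obtain m n where x: "x = of_int m * \<tau> + of_int n" by (auto simp: lattice1_def)
  show "- x \<in> lattice1 \<tau>" using I[of "- m" "- n"] by (simp add: x)
  fix y assume "y \<in> lattice1 \<tau>"
  then obtain m' n' where y: "y = of_int m' * \<tau> + of_int n'" by (auto simp: lattice1_def)
  show "x + y \<in> lattice1 \<tau>" using I[of "m + m'" "n + n'"] by (simp add: x y algebra_simps)
qed

lemma lattice1_induct [consumes 1, case_names zero one tau add uminus]:
  assumes "l \<in> lattice1 \<tau>" and "P 0" "P 1" "P \<tau>"
    and add: "\<And>x y. P x \<Longrightarrow> P y \<Longrightarrow> P (x + y)" and minus: "\<And>x. P x \<Longrightarrow> P (- x)"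
  shows "P l"
proof -
  obtain m n where l: "l = of_int m * \<tau> + of_int n" using assms(1) by (auto simp: lattice1_def)
  have nat: "P (of_nat k * a)" if "P a" for k a
    by (induction k) (use \<open>P 0\<close> add that in \<open>auto simp: algebra_simps\<close>)
  have int: "P (of_int k * a)" if "P a" for k a
    using nat[OF that, of "nat k"] minus[OF nat[OF that, of "nat (- k)"]] by (cases "k \<ge> 0") auto
  show ?thesis using add[OF int[OF \<open>P \<tau>\<close>, of m] int[OF \<open>P 1\<close>, of n]] by (simp add: l)
qed

text \<open>
  Periodicity confines the values to those on one compact period parallelogram, so Liouville's
  theorem applies.
\<close>

lemma elliptic_entire_constant:
  fixes f :: "complex \<Rightarrow> complex"
  assumes \<tau>: "Im \<tau> \<noteq> 0" and f: "f holomorphic_on UNIV"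
    and f1: "\<And>z. f (z + 1) = f z" and f\<tau>: "\<And>z. f (z + \<tau>) = f z"
  shows "f z = f w"
proof -
  have per: "\<forall>z. f (z + l) = f z" if "l \<in> lattice1 \<tau>" for l
    using that
  proof (induction rule: lattice1_induct)
    case (add x y)
    then show ?case by (simp flip: add.assoc)
  next
    case (uminus x)
    then show ?case by (metis diff_add_cancel uminus_add_conv_diff add.commute)
  qed (use f1 f\<tau> in auto)
  have "range f \<subseteq> f ` parallelogram \<tau>"
  proof
    fix y assume "y \<in> range f"
    then obtain z where y: "y = f z" by auto
    obtain w l where "w \<in> parallelogram \<tau>" "l \<in> lattice1 \<tau>" "z = w + l"
      using parallelogram_reduction[OF \<tau>] .
    with per y show "y \<in> f ` parallelogram \<tau>" by auto
  qed
  moreover have "compact (f ` parallelogram \<tau>)"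
    by (intro compact_continuous_image compact_parallelogram
        holomorphic_on_imp_continuous_on holomorphic_on_subset[OF f]) auto
  ultimately have "bounded (range f)" using bounded_subset compact_imp_bounded by blast
  then have "f constant_on UNIV" by (rule Liouville_theorem[OF f])
  then show ?thesis by (auto simp: constant_on_def)
qed

section \<open>The product over the powers of the nome\<close>

text \<open>
  This is the \<open>q\<close>-Pochhammer symbol \<open>(w; q)\<^sub>\<infinity>\<close>.
\<close>

definition nome_product :: "complex \<Rightarrow> complex \<Rightarrow> complex" where
  "nome_product q w = (\<Prod>n. 1 - q ^ n * w)"

lemma convergent_nome_product:
  fixes q w :: complex
  assumes "norm q < 1"
  shows "convergent_prod (\<lambda>n. 1 - q ^ n * w)"
proof -
  have "summable (\<lambda>n. norm (q ^ n * w))"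
    unfolding norm_mult norm_power using assms by (intro summable_mult2 summable_geometric) auto
  then have "abs_convergent_prod (\<lambda>n. 1 - q ^ n * w)"
    by (intro summable_imp_abs_convergent_prod) simp
  then show ?thesis by (rule abs_convergent_prod_imp_convergent_prod)
qed

lemma nome_product_nonzero:
  assumes "norm q < 1" and "\<And>n. q ^ n * w \<noteq> 1"
  shows "nome_product q w \<noteq> 0"
  unfolding nome_product_def
  by (rule prodinf_nonzero[OF convergent_nome_product]) (use assms in auto)

lemma nome_product_shift:
  assumes "norm q < 1"
  shows "nome_product q w = (1 - w) * nome_product q (q * w)"
proof -
  have "(\<lambda>n. 1 - q ^ n * w) has_prod ((\<Prod>k<1. 1 - q ^ k * w) * (\<Prod>k. 1 - q ^ (k + 1) * w))"
    by (rule has_prod_ignore_initial_segment'[OF convergent_nome_product[OF assms]])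
  then show ?thesis
    unfolding nome_product_def using has_prod_unique by (fastforce simp: mult_ac)
qed

lemma holomorphic_nome_product:
  assumes q: "norm q < 1"
  shows "nome_product q holomorphic_on UNIV"
proof (rule holomorphic_uniform_sequence[of UNIV "\<lambda>N w. \<Prod>n<N. 1 - q ^ n * w"])
  fix x :: complex
  have "uniformly_convergent_on (cball x 1) (\<lambda>N w. \<Prod>n<N. 1 - q ^ n * w)"
  proof (rule uniformly_convergent_on_prod')
    show "uniformly_convergent_on (cball x 1) (\<lambda>N w. \<Sum>n<N. norm (1 - q ^ n * w - 1))"
    proof (rule Weierstrass_m_test')
      fix n w assume "w \<in> cball x 1"
      then have "norm w \<le> norm x + 1"
        by (metis add.commute dist_norm mem_cball norm_minus_commute norm_triangle_sub
            add_left_mono order_trans)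
      then show "norm (norm (1 - q ^ n * w - 1)) \<le> norm q ^ n * (norm x + 1)"
        by (simp add: norm_mult norm_power mult_left_mono)
    next
      show "summable (\<lambda>n. norm q ^ n * (norm x + 1))"
        using q by (intro summable_mult2 summable_geometric) auto
    qed
  qed (auto intro!: continuous_intros)
  then obtain g where g: "uniform_limit (cball x 1) (\<lambda>N w. \<Prod>n<N. 1 - q ^ n * w) g sequentially"
    by (auto simp: uniformly_convergent_on_def)
  have "g w = nome_product q w" if "w \<in> cball x 1" for w
  proof -
    have "(\<lambda>N. \<Prod>n\<le>N. 1 - q ^ n * w) \<longlonglongrightarrow> nome_product q w"
      unfolding nome_product_def by (intro convergent_prod_LIMSEQ convergent_nome_product q)
    then have "(\<lambda>N. \<Prod>n<N. 1 - q ^ n * w) \<longlonglongrightarrow> nome_product q w"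
      by (simp only: LIMSEQ_lessThan_iff_atMost)
    with tendsto_uniform_limitI[OF g that] show ?thesis by (rule LIMSEQ_unique)
  qed
  then have "uniform_limit (cball x 1) (\<lambda>N w. \<Prod>n<N. 1 - q ^ n * w) (nome_product q) sequentially"
    using g uniform_limit_cong'[of "cball x 1"] by (metis (no_types, lifting))
  then show "\<exists>d>0. cball x d \<subseteq> UNIV \<and>
      uniform_limit (cball x d) (\<lambda>N w. \<Prod>n<N. 1 - q ^ n * w) (nome_product q) sequentially"
    by (intro exI[of _ 1]) auto
qed (auto intro!: holomorphic_intros)

section \<open>Theta functions of one variable\<close>

definition kappa :: "complex \<Rightarrow> complex" where
  "kappa \<tau> = of_real (pi / Im \<tau>)"

text \<open>
  The multipliers are those of the \<open>n\<close>-th power of an automorphy factor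
  \<open>\<chi>(\<lambda>) exp (\<pi> z cnj \<lambda> / Im \<tau> + const)\<close> at the generators \<open>\<lambda> = 1\<close> and \<open>\<lambda> = \<tau>\<close> of the lattice. The
  constants \<open>A\<close> and \<open>C\<close> are left arbitrary because translating or dividing a theta function
  changes them, while the degree \<open>n\<close> behaves additively.
\<close>

definition theta_space :: "complex \<Rightarrow> nat \<Rightarrow> complex \<Rightarrow> complex \<Rightarrow> (complex \<Rightarrow> complex) set" where
  "theta_space \<tau> n A C = {f. f holomorphic_on UNIV \<and>
     (\<forall>z. f (z + 1) = A * exp (of_nat n * kappa \<tau> * z) * f z) \<and>
     (\<forall>z. f (z + \<tau>) = C * exp (of_nat n * kappa \<tau> * cnj \<tau> * z) * f z)}"

lemma theta_spaceD:
  assumes "f \<in> theta_space \<tau> n A C"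
  shows theta_space_holomorphic: "f holomorphic_on UNIV"
    and theta_space_one: "f (z + 1) = A * exp (of_nat n * kappa \<tau> * z) * f z"
    and theta_space_tau: "f (z + \<tau>) = C * exp (of_nat n * kappa \<tau> * cnj \<tau> * z) * f z"
  using assms by (auto simp: theta_space_def)

text \<open>
  This is the Legendre relation of the two generators: it makes the two functional equations
  compatible.
\<close>

lemma kappa_tau_diff:
  assumes "Im \<tau> \<noteq> 0"
  shows "kappa \<tau> * (\<tau> - cnj \<tau>) = 2 * of_real pi * \<i>"
  using assms by (simp add: kappa_def complex_eq_iff)

lemma theta_space_translate:
  assumes "f \<in> theta_space \<tau> n A C"
  shows "(\<lambda>z. f (z + a)) \<in> theta_space \<tau> n
    (A * exp (of_nat n * kappa \<tau> * a)) (C * exp (of_nat n * kappa \<tau> * cnj \<tau> * a))"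
  unfolding theta_space_def
proof (intro CollectI conjI allI)
  show "(\<lambda>z. f (z + a)) holomorphic_on UNIV"
    using theta_space_holomorphic[OF assms] by (rule entire_compose) (intro holomorphic_intros)
  show "f (z + 1 + a) = A * exp (of_nat n * kappa \<tau> * a) * exp (of_nat n * kappa \<tau> * z) * f (z + a)" for z
    using theta_space_one[OF assms, of "z + a"] by (simp add: add_ac exp_add ring_distribs)
  show "f (z + \<tau> + a) = C * exp (of_nat n * kappa \<tau> * cnj \<tau> * a) *
      exp (of_nat n * kappa \<tau> * cnj \<tau> * z) * f (z + a)" for z
    using theta_space_tau[OF assms, of "z + a"] by (simp add: add_ac exp_add ring_distribs)
qed

lemma theta_space_mult:
  assumes "f \<in> theta_space \<tau> n A C" "g \<in> theta_space \<tau> m B D"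
  shows "(\<lambda>z. f z * g z) \<in> theta_space \<tau> (n + m) (A * B) (C * D)"
  using theta_spaceD[OF assms(1)] theta_spaceD[OF assms(2)]
  by (auto simp: theta_space_def exp_add ring_distribs intro!: holomorphic_intros)

lemma theta_space_power:
  assumes "f \<in> theta_space \<tau> n A C"
  shows "(\<lambda>z. f z ^ m) \<in> theta_space \<tau> (m * n) (A ^ m) (C ^ m)"
proof (induction m)
  case 0
  show ?case by (simp add: theta_space_def)
next
  case (Suc m)
  from theta_space_mult[OF assms this] show ?case by simp
qed

lemma theta_space_exp: "(\<lambda>z. exp (B * z)) \<in> theta_space \<tau> 0 (exp B) (exp (B * \<tau>))"
  by (auto simp: theta_space_def exp_add ring_distribs intro!: holomorphic_intros)

lemma theta_space_diff_scale:
  assumes "f \<in> theta_space \<tau> n A C" "g \<in> theta_space \<tau> n A C"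
  shows "(\<lambda>z. f z - c * g z) \<in> theta_space \<tau> n A C"
  using theta_spaceD[OF assms(1)] theta_spaceD[OF assms(2)]
  by (auto simp: theta_space_def algebra_simps intro!: holomorphic_intros)

text \<open>
  The functional equations for the two generators propagate to the whole lattice, with a factor that
  has no zeros; only that is needed to transport zeros and their multiplicities.
\<close>

lemma theta_space_lattice_shift:
  assumes f: "f \<in> theta_space \<tau> n A C" and nz: "A \<noteq> 0" "C \<noteq> 0" and l: "l \<in> lattice1 \<tau>"
  obtains u where "u holomorphic_on UNIV" "\<And>z. u z \<noteq> 0" "\<And>z. f (z + l) = u z * f z"
proof -
  have "\<exists>u. u holomorphic_on UNIV \<and> (\<forall>z. u z \<noteq> 0) \<and> (\<forall>z. f (z + l) = u z * f z)"
    using l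
  proof (induction rule: lattice1_induct)
    case zero
    show ?case by (intro exI[of _ "\<lambda>_. 1"]) auto
  next
    case one
    show ?case
      by (intro exI[of _ "\<lambda>z. A * exp (of_nat n * kappa \<tau> * z)"])
        (use nz theta_space_one[OF f] in \<open>auto intro!: holomorphic_intros\<close>)
  next
    case tau
    show ?case
      by (intro exI[of _ "\<lambda>z. C * exp (of_nat n * kappa \<tau> * cnj \<tau> * z)"])
        (use nz theta_space_tau[OF f] in \<open>auto intro!: holomorphic_intros\<close>)
  next
    case (add x y)
    then obtain u v where u: "u holomorphic_on UNIV" "\<And>z. u z \<noteq> 0" "\<And>z. f (z + x) = u z * f z"
      and v: "v holomorphic_on UNIV" "\<And>z. v z \<noteq> 0" "\<And>z. f (z + y) = v z * f z" by auto
    show ?case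
    proof (intro exI[of _ "\<lambda>z. v (z + x) * u z"] conjI allI)
      show "(\<lambda>z. v (z + x) * u z) holomorphic_on UNIV"
        by (intro holomorphic_intros u entire_compose[OF v(1)])
      show "f (z + (x + y)) = v (z + x) * u z * f z" for z
        using v(3)[of "z + x"] u(3)[of z] by (simp add: add_ac)
    qed (use u v in auto)
  next
    case (uminus x)
    then obtain u where u: "u holomorphic_on UNIV" "\<And>z. u z \<noteq> 0" "\<And>z. f (z + x) = u z * f z"
      by auto
    show ?case
    proof (intro exI[of _ "\<lambda>z. inverse (u (z - x))"] conjI allI)
      show "(\<lambda>z. inverse (u (z - x))) holomorphic_on UNIV"
        by (intro holomorphic_intros entire_compose[OF u(1)]) (use u in auto)
      show "f (z + - x) = inverse (u (z - x)) * f z" for z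
        using u(3)[of "z - x"] u(2) by (simp add: field_simps)
    qed (use u in auto)
  qed
  then show thesis using that by blast
qed

lemma theta_space_zero_shift:
  assumes "f \<in> theta_space \<tau> n A C" and "A \<noteq> 0" "C \<noteq> 0" and "l \<in> lattice1 \<tau>"
  shows "f (z + l) = 0 \<longleftrightarrow> f z = 0"
    and "f z = 0 \<Longrightarrow> deriv f z \<noteq> 0 \<Longrightarrow> deriv f (z + l) \<noteq> 0"
proof -
  obtain u where u: "u holomorphic_on UNIV" "\<And>z. u z \<noteq> 0" "\<And>z. f (z + l) = u z * f z"
    using theta_space_lattice_shift[OF assms] by blast
  show "f (z + l) = 0 \<longleftrightarrow> f z = 0" using u by simp
  assume z: "f z = 0" "deriv f z \<noteq> 0"
  have f: "f holomorphic_on UNIV" using theta_space_holomorphic[OF assms(1)] .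
  have "((\<lambda>w. f (w + l)) has_field_derivative deriv f (z + l)) (at z)"
    by (rule entire_translate_has_deriv[OF f])
  moreover have "((\<lambda>w. f (w + l)) has_field_derivative deriv u z * f z + deriv f z * u z) (at z)"
    unfolding u(3) by (rule DERIV_mult[OF entire_has_deriv[OF u(1)] entire_has_deriv[OF f]])
  ultimately have "deriv f (z + l) = deriv u z * f z + deriv f z * u z" by (rule DERIV_unique)
  then show "deriv f (z + l) \<noteq> 0" using z u by simp
qed

text \<open>
  The multipliers of \<open>f z\<close> and \<open>f (- z)\<close> are inverse to each other, so \<open>f z * f (- z)\<close> is elliptic and
  hence constant; a single zero of \<open>f\<close> would make this constant, and then \<open>f\<close>, vanish. Without zeros
  the logarithmic derivative of \<open>f\<close> is an elliptic entire function, so it is a constant \<open>l\<close> and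
  \<open>f\<close> is a multiple of \<open>exp (l * z)\<close>.
\<close>

lemma theta_space_degree_0:
  assumes \<tau>: "Im \<tau> \<noteq> 0" and f: "f \<in> theta_space \<tau> 0 A C" and nz: "A \<noteq> 0" "C \<noteq> 0"
    and a: "f a \<noteq> 0"
  shows theta_space_degree_0_nonzero: "f z \<noteq> 0"
    and theta_space_degree_0_exp: "\<exists>l. A = exp l \<and> C = exp (l * \<tau>)"
proof -
  have hol: "f holomorphic_on UNIV" using theta_space_holomorphic[OF f] .
  have f1: "f (z + 1) = A * f z" and f\<tau>: "f (z + \<tau>) = C * f z" for z
    using theta_space_one[OF f, of z] theta_space_tau[OF f, of z] by simp_all
  have hol': "(\<lambda>z. f (- z)) holomorphic_on UNIV"
    by (rule entire_compose[OF hol]) (intro holomorphic_intros)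
  define g where "g z = f z * f (- z)" for z
  have gh: "g holomorphic_on UNIV"
    unfolding g_def by (intro holomorphic_intros hol hol')
  have neg: "A * f (- z - 1) = f (- z)" "C * f (- z - \<tau>) = f (- z)" for z
    using f1[of "- z - 1"] f\<tau>[of "- z - \<tau>"] by simp_all
  have g: "g z = g w" for z w
  proof (rule elliptic_entire_constant[OF \<tau> gh])
    show "g (z + 1) = g z" "g (z + \<tau>) = g z" for z
      using neg[of z] by (simp_all add: g_def f1 f\<tau>)
  qed
  have nonzero: "f z \<noteq> 0" for z
  proof
    assume "f z = 0"
    then have "g w = 0" for w using g[of w z] by (simp add: g_def)
    then have "f w * f (- w) = 0" for w by (simp add: g_def)
    then have "f w = 0" for w by (rule entire_mult_eq_0[OF hol hol', of "- a"]) (use a in auto)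
    with a show False by blast
  qed
  then show "f z \<noteq> 0" .
  note df = entire_has_deriv[OF hol]
  have d: "deriv f (z + c) = B * deriv f z" if "\<And>z. f (z + c) = B * f z" for z c B
  proof -
    have "((\<lambda>w. f (w + c)) has_field_derivative deriv f (z + c)) (at z)"
      by (rule entire_translate_has_deriv[OF hol])
    moreover have "((\<lambda>w. f (w + c)) has_field_derivative B * deriv f z) (at z)"
      unfolding that by (rule DERIV_cmult[OF df])
    ultimately show ?thesis by (rule DERIV_unique)
  qed
  define h where "h z = deriv f z / f z" for z
  have hh: "h holomorphic_on UNIV"
    unfolding h_def by (intro holomorphic_intros holomorphic_deriv hol) (use nonzero in auto)
  have h: "h z = h w" for z w
  proof (rule elliptic_entire_constant[OF \<tau> hh])
    show "h (z + 1) = h z" "h (z + \<tau>) = h z" for z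
      using nz by (simp_all add: h_def f1 f\<tau> d[OF f1] d[OF f\<tau>])
  qed
  define l where "l = h 0"
  have df': "deriv f z = l * f z" for z using h[of z 0] nonzero[of z] by (simp add: h_def l_def field_simps)
  have "((\<lambda>z. f z * exp (- l * z)) has_field_derivative 0) (at z)" for z
    by (rule DERIV_cong[OF DERIV_mult[OF df]], (rule derivative_eq_intros refl)+)
      (simp add: df')
  then obtain c where "\<And>z. f z * exp (- l * z) = c"
    using has_field_derivative_zero_constant[of UNIV "\<lambda>z. f z * exp (- l * z)"] by auto
  from this this[of 0] have c: "f z * exp (- l * z) = f 0" for z by simp
  have fe: "f z = f 0 * exp (l * z)" for z
    using c[of z] by (simp add: exp_minus field_simps)
  show "\<exists>l. A = exp l \<and> C = exp (l * \<tau>)"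
    using f1[of 0] f\<tau>[of 0] fe[of 1] fe[of \<tau>] nonzero[of 0] by (intro exI[of _ l]) auto
qed

section \<open>A theta function with zeros exactly at the lattice points\<close>

text \<open>
  With \<open>w = exp (2 \<pi> \<i> z)\<close> and \<open>q = exp (2 \<pi> \<i> \<tau>)\<close> the second factor is \<open>(w; q)\<^sub>\<infinity> (q / w; q)\<^sub>\<infinity>\<close>, the product
  side of Jacobi's triple product identity up to a constant. The Gaussian factor turns its
  multiplier \<open>- 1 / w\<close> under \<open>\<tau>\<close> into the symmetric normalization of \<open>theta_space\<close>. Starting from the
  product makes the zeros visible.
\<close>

definition sigma_theta :: "complex \<Rightarrow> complex \<Rightarrow> complex" where
  "sigma_theta \<tau> z = exp (kappa \<tau> * z\<^sup>2 / 2) *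
     (nome_product (exp (2 * of_real pi * \<i> * \<tau>)) (exp (2 * of_real pi * \<i> * z)) *
      nome_product (exp (2 * of_real pi * \<i> * \<tau>)) (exp (2 * of_real pi * \<i> * (\<tau> - z))))"

context
  fixes \<tau> :: complex
  assumes \<tau>: "Im \<tau> > 0"
begin

lemma norm_nome: "norm (exp (2 * of_real pi * \<i> * \<tau>)) < 1"
  using \<tau> by (simp add: norm_exp_eq_Re)

lemma sigma_theta_in_theta_space:
  "sigma_theta \<tau> \<in> theta_space \<tau> 1 (exp (kappa \<tau> / 2)) (- exp (kappa \<tau> * \<tau>\<^sup>2 / 2))"
  unfolding theta_space_def
proof (intro CollectI conjI allI)
  let ?q = "exp (2 * of_real pi * \<i> * \<tau>)"
  let ?P = "nome_product ?q"
  note hol = holomorphic_nome_product[OF norm_nome]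
  show "sigma_theta \<tau> holomorphic_on UNIV"
    unfolding sigma_theta_def by (intro holomorphic_intros entire_compose[OF hol]) auto
  have e: "exp (2 * of_real pi * \<i> * (z + 1)) = exp (2 * of_real pi * \<i> * z)" for z
    by (simp add: ring_distribs exp_add)
  have e': "exp (2 * of_real pi * \<i> * (\<tau> - (z + 1))) = exp (2 * of_real pi * \<i> * (\<tau> - z))" for z
    using e[of "\<tau> - (z + 1)"] by simp
  show "sigma_theta \<tau> (z + 1) =
      exp (kappa \<tau> / 2) * exp (of_nat 1 * kappa \<tau> * z) * sigma_theta \<tau> z" for z
  proof -
    have "kappa \<tau> * (z + 1)\<^sup>2 / 2 = kappa \<tau> / 2 + kappa \<tau> * z + kappa \<tau> * z\<^sup>2 / 2"
      by (simp add: power2_eq_square field_simps)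
    then have "exp (kappa \<tau> * (z + 1)\<^sup>2 / 2) =
        exp (kappa \<tau> / 2) * exp (kappa \<tau> * z) * exp (kappa \<tau> * z\<^sup>2 / 2)"
      by (simp only: exp_add)
    then show ?thesis unfolding sigma_theta_def e e' by simp
  qed
  show "sigma_theta \<tau> (z + \<tau>) =
      - exp (kappa \<tau> * \<tau>\<^sup>2 / 2) * exp (of_nat 1 * kappa \<tau> * cnj \<tau> * z) * sigma_theta \<tau> z" for z
  proof -
    define w where "w = exp (2 * of_real pi * \<i> * z)"
    have w: "w \<noteq> 0" by (simp add: w_def)
    have w1: "exp (2 * of_real pi * \<i> * (z + \<tau>)) = ?q * w"
      by (simp add: w_def distrib_left exp_add)
    have w2: "exp (2 * of_real pi * \<i> * (\<tau> - (z + \<tau>))) = 1 / w"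
      by (simp add: w_def exp_minus inverse_eq_divide)
    have w3: "exp (2 * of_real pi * \<i> * (\<tau> - z)) = ?q / w"
      by (simp add: w_def right_diff_distrib exp_diff)
    have P1: "?P 1 = 0" using nome_product_shift[OF norm_nome, of 1] by simp
    \<comment> \<open>The factor \<open>1 - w\<close> is lost and \<open>1 - 1 / w\<close> is gained; at \<open>w = 1\<close> both sides vanish.\<close>
    have prod: "?P (?q * w) * ?P (1 / w) = - (1 / w) * (?P w * ?P (?q / w))"
    proof (cases "w = 1")
      case False
      have "(1 - w) * (?P (?q * w) * ?P (1 / w)) = ?P w * ((1 - 1 / w) * ?P (?q / w))"
        using nome_product_shift[OF norm_nome, of w] nome_product_shift[OF norm_nome, of "1 / w"]
        by (simp add: mult_ac)
      also have "\<dots> = (1 - w) * (- (1 / w) * (?P w * ?P (?q / w)))"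
        using w by (simp add: field_simps)
      finally show ?thesis by (rule mult_left_cancel[THEN iffD1, rotated]) (use False in simp)
    qed (simp add: P1)
    have "kappa \<tau> * (z + \<tau>)\<^sup>2 / 2 =
        kappa \<tau> * z\<^sup>2 / 2 + kappa \<tau> * \<tau>\<^sup>2 / 2 + kappa \<tau> * cnj \<tau> * z + kappa \<tau> * (\<tau> - cnj \<tau>) * z"
      by (simp add: power2_eq_square field_simps)
    also have "kappa \<tau> * (\<tau> - cnj \<tau>) * z = 2 * of_real pi * \<i> * z"
      using kappa_tau_diff \<tau> by simp
    finally have ex: "exp (kappa \<tau> * (z + \<tau>)\<^sup>2 / 2) =
        exp (kappa \<tau> * z\<^sup>2 / 2) * exp (kappa \<tau> * \<tau>\<^sup>2 / 2) * exp (kappa \<tau> * cnj \<tau> * z) * w"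
      by (simp only: exp_add w_def)
    show ?thesis
      unfolding sigma_theta_def w1 w2 w3 ex prod using w by (simp add: w_def[symmetric])
  qed
qed

text \<open>
  Splitting off the factor \<open>1 - w\<close> of the product isolates the zero at the origin.
\<close>

lemma sigma_theta_near_0: "sigma_theta \<tau> 0 = 0" "deriv (sigma_theta \<tau>) 0 \<noteq> 0"
proof -
  let ?q = "exp (2 * of_real pi * \<i> * \<tau>)"
  let ?P = "nome_product ?q"
  define R where "R z = exp (kappa \<tau> * z\<^sup>2 / 2) *
    (?P (?q * exp (2 * of_real pi * \<i> * z)) * ?P (exp (2 * of_real pi * \<i> * (\<tau> - z))))" for z
  note hol = holomorphic_nome_product[OF norm_nome]
  have R: "R holomorphic_on UNIV"
    unfolding R_def by (intro holomorphic_intros entire_compose[OF hol]) auto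
  have s: "sigma_theta \<tau> = (\<lambda>z. (1 - exp (2 * of_real pi * \<i> * z)) * R z)"
  proof
    show "sigma_theta \<tau> z = (1 - exp (2 * of_real pi * \<i> * z)) * R z" for z
      unfolding sigma_theta_def R_def
      by (subst nome_product_shift[OF norm_nome, of "exp (2 * of_real pi * \<i> * z)"]) simp
  qed
  show "sigma_theta \<tau> 0 = 0" by (simp add: s)
  have "?q ^ n * ?q \<noteq> 1" for n
  proof
    assume "?q ^ n * ?q = 1"
    then have "norm ?q ^ Suc n = 1" by (metis norm_one norm_power power_Suc2)
    then show False using power_less_one_iff[of "norm ?q" "Suc n"] norm_nome by simp
  qed
  then have "?P ?q \<noteq> 0" by (intro nome_product_nonzero norm_nome)
  then have R0: "R 0 \<noteq> 0" by (simp add: R_def)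
  note dR = entire_has_deriv[OF R, of 0]
  have "(sigma_theta \<tau> has_field_derivative - (2 * of_real pi * \<i>) * R 0) (at 0)"
    unfolding s by (rule DERIV_cong[OF DERIV_mult[OF _ dR]], (rule derivative_eq_intros refl)+) simp
  then show "deriv (sigma_theta \<tau>) 0 \<noteq> 0" using R0 by (simp add: DERIV_imp_deriv)
qed

lemma sigma_theta_eq_0_iff: "sigma_theta \<tau> z = 0 \<longleftrightarrow> z \<in> lattice1 \<tau>"
proof
  assume "z \<in> lattice1 \<tau>"
  then show "sigma_theta \<tau> z = 0"
    using theta_space_zero_shift(1)[OF sigma_theta_in_theta_space, of z 0] sigma_theta_near_0 by simp
next
  let ?q = "exp (2 * of_real pi * \<i> * \<tau>)"
  have L: "x \<in> lattice1 \<tau>" if eq: "?q ^ n * exp (2 * of_real pi * \<i> * x) = 1" for n x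
  proof -
    have "exp (2 * of_real pi * \<i> * (of_nat n * \<tau> + x)) = 1"
      using eq by (simp add: exp_add ring_distribs exp_of_nat_mult[symmetric] mult_ac)
    then obtain k :: int where "2 * of_real pi * \<i> * (of_nat n * \<tau> + x) = of_int (2 * k) * pi * \<i>"
      using exp_eq_1[of "2 * of_real pi * \<i> * (of_nat n * \<tau> + x)"] by (auto simp: complex_eq_iff)
    then have "(2 * of_real pi * \<i>) * (of_nat n * \<tau> + x) = (2 * of_real pi * \<i>) * of_int k"
      by (simp add: mult_ac)
    then have "of_nat n * \<tau> + x = of_int k" by (subst (asm) mult_cancel_left) auto
    then have "x = of_int (- int n) * \<tau> + of_int k" by (simp add: algebra_simps)
    then show ?thesis unfolding lattice1_def by blast
  qed
  assume "sigma_theta \<tau> z = 0"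
  then obtain n where "?q ^ n * exp (2 * of_real pi * \<i> * z) = 1 \<or>
      ?q ^ n * exp (2 * of_real pi * \<i> * (\<tau> - z)) = 1"
    unfolding sigma_theta_def using nome_product_nonzero[OF norm_nome] by fastforce
  then have "z \<in> lattice1 \<tau> \<or> \<tau> - z \<in> lattice1 \<tau>" using L by blast
  then show "z \<in> lattice1 \<tau>"
    using add_in_lattice1[OF tau_in_lattice1[of \<tau>] uminus_in_lattice1[of "\<tau> - z" \<tau>]] by auto
qed

lemma sigma_theta_simple: "z \<in> lattice1 \<tau> \<Longrightarrow> deriv (sigma_theta \<tau>) z \<noteq> 0"
  using theta_space_zero_shift(2)[OF sigma_theta_in_theta_space, of z 0] sigma_theta_near_0 by simp

end

section \<open>Existence, uniqueness and separation of theta functions\<close>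

lemma theta_space_divide:
  assumes f: "f \<in> theta_space \<tau> (n + m) A C" and s: "s \<in> theta_space \<tau> m B D"
    and nz: "B \<noteq> 0" "D \<noteq> 0" and a: "s a \<noteq> 0"
    and g: "g holomorphic_on UNIV" and fg: "\<And>z. f z = g z * s z"
  shows "g \<in> theta_space \<tau> n (A / B) (C / D)"
proof -
  have hs: "s holomorphic_on UNIV" using theta_space_holomorphic[OF s] .
  have key: "g (z + c) = M / N * exp (of_nat n * x * z) * g z"
    if F: "\<And>z. f (z + c) = M * exp (of_nat (n + m) * x * z) * f z"
      and S: "\<And>z. s (z + c) = N * exp (of_nat m * x * z) * s z" and N: "N \<noteq> 0" for c M N x z
  proof -
    have "(g (z + c) - M / N * exp (of_nat n * x * z) * g z) * s z = 0" for z
    proof -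
      have "g (z + c) * (N * exp (of_nat m * x * z) * s z) =
          M * (exp (of_nat n * x * z) * exp (of_nat m * x * z)) * (g z * s z)"
        using F[of z] S[of z] fg[of "z + c"] fg[of z] by (simp add: ring_distribs exp_add)
      then have "exp (of_nat m * x * z) * N *
          ((g (z + c) - M / N * exp (of_nat n * x * z) * g z) * s z) = 0"
        using N by (simp add: field_simps)
      then show ?thesis using N by simp
    qed
    moreover have "(\<lambda>z. g (z + c) - M / N * exp (of_nat n * x * z) * g z) holomorphic_on UNIV"
      by (intro holomorphic_intros g entire_compose[OF g])
    ultimately have "g (z + c) - M / N * exp (of_nat n * x * z) * g z = 0"
      using entire_mult_eq_0[OF _ hs _ a] by blast
    then show ?thesis by simp
  qed
  show ?thesis
    unfolding theta_space_def
    using g key[of 1 A "kappa \<tau>" B] key[of \<tau> C "kappa \<tau> * cnj \<tau>" D]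
      theta_space_one[OF f] theta_space_tau[OF f] theta_space_one[OF s] theta_space_tau[OF s] nz
    by (simp add: mult.assoc)
qed

text \<open>
  Translating \<open>sigma_theta\<close> by \<open>a\<close> and multiplying it by \<open>exp (b * z)\<close> changes the logarithms of the two
  multipliers by a linear function of \<open>(a, b)\<close>, which is invertible because its determinant
  \<open>kappa \<tau> * (\<tau> - cnj \<tau>)\<close> is nonzero. So any two multipliers can be reached.
\<close>

lemma theta_space_1_exists:
  assumes \<tau>: "Im \<tau> > 0" and nz: "A \<noteq> 0" "C \<noteq> 0"
  obtains \<theta> z0 where "\<theta> \<in> theta_space \<tau> 1 A C" "\<And>z. \<theta> z = 0 \<longleftrightarrow> z - z0 \<in> lattice1 \<tau>"
    "\<And>z. \<theta> z = 0 \<Longrightarrow> deriv \<theta> z \<noteq> 0"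
proof -
  define la where "la = Ln (A / exp (kappa \<tau> / 2))"
  define lc where "lc = Ln (C / (- exp (kappa \<tau> * \<tau>\<^sup>2 / 2)))"
  \<comment> \<open>Cramer's rule for \<open>kappa \<tau> * a + b = la\<close> and \<open>kappa \<tau> * cnj \<tau> * a + b * \<tau> = lc\<close>\<close>
  define a where "a = (\<tau> * la - lc) / (2 * of_real pi * \<i>)"
  define b where "b = la - kappa \<tau> * a"
  have ea: "exp la = A / exp (kappa \<tau> / 2)" and ec: "exp lc = C / (- exp (kappa \<tau> * \<tau>\<^sup>2 / 2))"
    unfolding la_def lc_def using nz by (simp_all only: exp_Ln divide_eq_0_iff neg_equal_0_iff_equal exp_not_eq_zero simp_thms)
  have "kappa \<tau> * (\<tau> - cnj \<tau>) * a = \<tau> * la - lc"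
    using kappa_tau_diff[of \<tau>] \<tau> by (simp add: a_def)
  then have lc: "kappa \<tau> * cnj \<tau> * a + b * \<tau> = lc" by (simp add: b_def algebra_simps)
  have la: "kappa \<tau> * a + b = la" by (simp add: b_def)
  define \<theta> where "\<theta> z = sigma_theta \<tau> (z + a) * exp (b * z)" for z
  note sig = sigma_theta_in_theta_space[OF \<tau>]
  have "(\<lambda>z. sigma_theta \<tau> (z + a) * exp (b * z)) \<in> theta_space \<tau> (1 + 0)
      (exp (kappa \<tau> / 2) * exp (of_nat 1 * kappa \<tau> * a) * exp b)
      (- exp (kappa \<tau> * \<tau>\<^sup>2 / 2) * exp (of_nat 1 * kappa \<tau> * cnj \<tau> * a) * exp (b * \<tau>))"
    by (rule theta_space_mult[OF theta_space_translate[OF sig] theta_space_exp])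
  also have "exp (kappa \<tau> / 2) * exp (of_nat 1 * kappa \<tau> * a) * exp b = A"
    unfolding mult.assoc using ea by (simp flip: exp_add add: la)
  also have "- exp (kappa \<tau> * \<tau>\<^sup>2 / 2) * exp (of_nat 1 * kappa \<tau> * cnj \<tau> * a) * exp (b * \<tau>) =
      - exp (kappa \<tau> * \<tau>\<^sup>2 / 2) * exp lc"
    by (simp add: mult.assoc add_ac flip: exp_add lc)
  also have "\<dots> = C" by (simp add: ec)
  finally have 1: "\<theta> \<in> theta_space \<tau> 1 A C" by (simp add: \<theta>_def[abs_def])
  have 2: "\<theta> z = 0 \<longleftrightarrow> z - (- a) \<in> lattice1 \<tau>" for z
    by (simp add: \<theta>_def sigma_theta_eq_0_iff[OF \<tau>])
  have 3: "deriv \<theta> z \<noteq> 0" if "\<theta> z = 0" for z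
  proof -
    have z: "z + a \<in> lattice1 \<tau>" using that 2 by simp
    note ds = entire_translate_has_deriv[OF theta_space_holomorphic[OF sig], of a z]
    have "(\<theta> has_field_derivative deriv (sigma_theta \<tau>) (z + a) * exp (b * z)) (at z)"
      unfolding \<theta>_def
      by (rule DERIV_cong[OF DERIV_mult[OF ds]], (rule derivative_eq_intros refl)+)
        (use z in \<open>simp add: sigma_theta_eq_0_iff[OF \<tau>]\<close>)
    then show ?thesis using sigma_theta_simple[OF \<tau> z] by (simp add: DERIV_imp_deriv)
  qed
  show thesis using that 1 2 3 by blast
qed

lemma half_not_in_lattice1:
  assumes "Im \<tau> > 0"
  shows "1 / 2 \<notin> lattice1 \<tau>"
proof
  assume "1 / 2 \<in> lattice1 \<tau>"
  then obtain m n where mn: "1 / 2 = of_int m * \<tau> + of_int n" by (auto simp: lattice1_def)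
  have "real_of_int m * Im \<tau> = 0" using arg_cong[OF mn, of Im] by simp
  then have "m = 0" using assms by simp
  then have "1 / 2 = real_of_int n" using arg_cong[OF mn, of Re] by simp
  then have "real_of_int (2 * n) = 1" by simp
  then have "2 * n = 1" by linarith
  then show False by presburger
qed

text \<open>
  Choose \<open>p\<close> outside the zero set \<open>z0 + \<Lambda>\<close> and subtract from \<open>f\<close> the multiple of \<open>\<theta>\<close> that agrees with
  it at \<open>p\<close>. The difference has a zero at \<open>p\<close>, so it is divisible by the translate of \<open>\<theta>\<close> whose zeros are
  \<open>p + \<Lambda>\<close>. If the quotient, of degree \<open>0\<close>, were not zero, it would be an exponential, and
  comparing multipliers would force \<open>z0 - p \<in> \<Lambda>\<close>.
\<close>

lemma theta_space_1_unique:
  assumes \<tau>: "Im \<tau> > 0" and nz: "A \<noteq> 0" "C \<noteq> 0" and f: "f \<in> theta_space \<tau> 1 A C"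
    and \<theta>: "\<theta> \<in> theta_space \<tau> 1 A C" and zeros: "\<And>z. \<theta> z = 0 \<longleftrightarrow> z - z0 \<in> lattice1 \<tau>"
    and simple: "\<And>z. \<theta> z = 0 \<Longrightarrow> deriv \<theta> z \<noteq> 0"
  obtains c where "\<And>z. f z = c * \<theta> z"
proof -
  \<comment> \<open>Any shift outside the lattice would serve.\<close>
  define a :: complex where "a = 1 / 2"
  have a: "a \<notin> lattice1 \<tau>" using half_not_in_lattice1[OF \<tau>] by (simp add: a_def)
  define p where "p = z0 - a"
  have na: "- a \<notin> lattice1 \<tau>" using uminus_in_lattice1[of "- a" \<tau>] a by auto
  then have "\<theta> p \<noteq> 0" by (simp add: zeros p_def)
  define c where "c = f p / \<theta> p"
  define K where "K z = f z - c * \<theta> z" for z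
  have K: "K \<in> theta_space \<tau> (0 + 1) A C"
    using theta_space_diff_scale[OF f \<theta>, of c] by (simp add: K_def[abs_def])
  have Kp: "K p = 0" using \<open>\<theta> p \<noteq> 0\<close> by (simp add: K_def c_def)
  define s where "s z = \<theta> (z + a)" for z
  have s: "s \<in> theta_space \<tau> 1 (A * exp (of_nat 1 * kappa \<tau> * a)) (C * exp (of_nat 1 * kappa \<tau> * cnj \<tau> * a))"
    unfolding s_def[abs_def] by (rule theta_space_translate[OF \<theta>])
  have dshift: "deriv s z = deriv \<theta> (z + a)" for z
    unfolding s_def[abs_def]
    by (intro DERIV_imp_deriv entire_translate_has_deriv theta_space_holomorphic[OF \<theta>])
  have "deriv s z \<noteq> 0 \<and> K z = 0" if "s z = 0" for z
  proof
    show "deriv s z \<noteq> 0" using that simple dshift by (simp add: s_def)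
    have "z - p \<in> lattice1 \<tau>" using that zeros by (simp add: s_def p_def algebra_simps)
    then show "K z = 0" using theta_space_zero_shift(1)[OF K nz, of "z - p" p] Kp by simp
  qed
  then obtain g where g: "g holomorphic_on UNIV" "\<And>z. K z = g z * s z"
    using entire_divide[OF theta_space_holomorphic[OF K] theta_space_holomorphic[OF s]] by blast
  have "s z0 \<noteq> 0" using a by (simp add: s_def zeros)
  then have "g \<in> theta_space \<tau> 0 (A / (A * exp (of_nat 1 * kappa \<tau> * a)))
      (C / (C * exp (of_nat 1 * kappa \<tau> * cnj \<tau> * a)))"
    by (intro theta_space_divide[OF K s _ _ _ g]) (use nz in auto)
  also have "A / (A * exp (of_nat 1 * kappa \<tau> * a)) = exp (- (kappa \<tau> * a))"
    using nz by (simp add: exp_minus field_simps)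
  also have "C / (C * exp (of_nat 1 * kappa \<tau> * cnj \<tau> * a)) = exp (- (kappa \<tau> * cnj \<tau> * a))"
    using nz by (simp add: exp_minus field_simps)
  finally have g0: "g \<in> theta_space \<tau> 0 (exp (- (kappa \<tau> * a))) (exp (- (kappa \<tau> * cnj \<tau> * a)))" .
  have "g z = 0" for z
  proof (rule ccontr)
    assume "g z \<noteq> 0"
    then obtain l where "exp (- (kappa \<tau> * a)) = exp l" "exp (- (kappa \<tau> * cnj \<tau> * a)) = exp (l * \<tau>)"
      using theta_space_degree_0_exp[OF _ g0] \<tau> by auto
    then obtain m n :: int where l: "- (kappa \<tau> * a) = l + of_int (2 * m) * pi * \<i>"
      "- (kappa \<tau> * cnj \<tau> * a) = l * \<tau> + of_int (2 * n) * pi * \<i>"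
      unfolding exp_eq by (auto simp: complex_eq_iff)
    \<comment> \<open>Eliminating \<open>l\<close> leaves the Legendre relation, which exhibits \<open>a\<close> as a lattice point.\<close>
    have "kappa \<tau> * (\<tau> - cnj \<tau>) * a =
        - (kappa \<tau> * cnj \<tau> * a) - (- (kappa \<tau> * a)) * \<tau>"
      by (simp add: algebra_simps)
    also have "\<dots> = (2 * of_real pi * \<i>) * (of_int (- m) * \<tau> + of_int n)"
      unfolding l by (simp add: algebra_simps)
    finally have "(2 * of_real pi * \<i>) * a = (2 * of_real pi * \<i>) * (of_int (- m) * \<tau> + of_int n)"
      using kappa_tau_diff[of \<tau>] \<tau> by simp
    then have "a = of_int (- m) * \<tau> + of_int n" by (subst (asm) mult_cancel_left) auto
    then show False using a unfolding lattice1_def by blast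
  qed
  then have "f z = c * \<theta> z" for z using g(2)[of z] by (simp add: K_def)
  then show thesis using that by blast
qed

text \<open>
  Induction on the degree: dividing by the translate of \<open>sigma_theta\<close> with zeros \<open>p + \<Lambda>\<close> uses up one
  point \<open>p\<close> and one degree, and leaves the zeros at the other points because these are incongruent
  to \<open>p\<close>. The last point remains for degree \<open>0\<close>, where one zero suffices.
\<close>

lemma theta_space_eq_0:
  assumes \<tau>: "Im \<tau> > 0"
  shows "finite P \<Longrightarrow> card P = Suc n \<Longrightarrow> f \<in> theta_space \<tau> n A C \<Longrightarrow> A \<noteq> 0 \<Longrightarrow> C \<noteq> 0 \<Longrightarrow>
    (\<And>p p'. p \<in> P \<Longrightarrow> p' \<in> P \<Longrightarrow> p \<noteq> p' \<Longrightarrow> p - p' \<notin> lattice1 \<tau>) \<Longrightarrow>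
    (\<And>p. p \<in> P \<Longrightarrow> f p = 0) \<Longrightarrow> f z = 0"
proof (induction n arbitrary: P f A C z)
  case 0
  then obtain p where "f p = 0" by (auto simp: card_Suc_eq)
  then show ?case using theta_space_degree_0_nonzero[OF _ \<open>f \<in> _\<close> \<open>A \<noteq> 0\<close> \<open>C \<noteq> 0\<close>, of z p] \<tau> by auto
next
  case (Suc n)
  obtain p Q where PQ: "P = insert p Q" "p \<notin> Q" "card Q = Suc n"
    using Suc.prems(2) card_Suc_eq[of P "Suc n"] by metis
  define s where "s z = sigma_theta \<tau> (z - p)" for z
  note sig = sigma_theta_in_theta_space[OF \<tau>]
  have s: "s \<in> theta_space \<tau> 1 (exp (kappa \<tau> / 2) * exp (of_nat 1 * kappa \<tau> * - p))
      (- exp (kappa \<tau> * \<tau>\<^sup>2 / 2) * exp (of_nat 1 * kappa \<tau> * cnj \<tau> * - p))"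
    using theta_space_translate[OF sig, of "- p"] by (simp add: s_def[abs_def])
  have f: "f \<in> theta_space \<tau> (n + 1) A C" using Suc.prems by simp
  have "deriv s z \<noteq> 0 \<and> f z = 0" if "s z = 0" for z
  proof
    have z: "z - p \<in> lattice1 \<tau>" using that by (simp add: s_def sigma_theta_eq_0_iff[OF \<tau>])
    have "f p = 0" using Suc.prems PQ by blast
    then show "f z = 0"
      using theta_space_zero_shift(1)[OF f _ _ z, of p] Suc.prems by simp
    have "(s has_field_derivative deriv (sigma_theta \<tau>) (z - p)) (at z)"
      using entire_translate_has_deriv[OF theta_space_holomorphic[OF sig], of "- p" z]
      by (simp add: s_def[abs_def])
    then show "deriv s z \<noteq> 0" using sigma_theta_simple[OF \<tau> z] by (simp add: DERIV_imp_deriv)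
  qed
  then obtain g where g: "g holomorphic_on UNIV" "\<And>z. f z = g z * s z"
    using entire_divide[OF theta_space_holomorphic[OF f] theta_space_holomorphic[OF s]] by blast
  have sq: "s q \<noteq> 0" if "q \<in> Q" for q
    using Suc.prems(6)[of q p] PQ that by (auto simp: s_def sigma_theta_eq_0_iff[OF \<tau>])
  obtain q0 where "q0 \<in> Q" using PQ(3) by fastforce
  have "g z = 0" for z
  proof (rule Suc.IH[where f = g and P = Q and z = z])
    show "finite Q" "card Q = Suc n" using Suc.prems PQ by auto
    show "g \<in> theta_space \<tau> n (A / (exp (kappa \<tau> / 2) * exp (of_nat 1 * kappa \<tau> * - p)))
       (C / (- exp (kappa \<tau> * \<tau>\<^sup>2 / 2) * exp (of_nat 1 * kappa \<tau> * cnj \<tau> * - p)))"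
      by (rule theta_space_divide[OF f s _ _ sq[OF \<open>q0 \<in> Q\<close>] g]) auto
    show "p - p' \<notin> lattice1 \<tau>" if "p \<in> Q" "p' \<in> Q" "p \<noteq> p'" for p p'
      using Suc.prems(6) that PQ by blast
    show "g q = 0" if "q \<in> Q" for q
      using g(2)[of q] sq[OF that] Suc.prems(7)[of q] that PQ by auto
  qed (use Suc.prems in auto)
  then show ?case using g(2) by simp
qed

lemma countable_lattice1: "countable (lattice1 \<tau>)"
proof -
  have "lattice1 \<tau> = (\<lambda>(m, n). of_int m * \<tau> + of_int n) ` UNIV"
    unfolding lattice1_def by auto
  then show ?thesis by simp
qed

lemma avoid_countable:
  assumes "countable (B :: complex set)"
  obtains t where "t \<notin> B"
  using assms uncountable_UNIV_complex by (metis UNIV_eq_I)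

text \<open>
  The points depend neither on the function nor on its multipliers, so the same points serve for the
  slices of a function of two variables in both directions.
\<close>

lemma theta_space_determining_points:
  assumes \<tau>: "Im \<tau> > 0"
  shows "\<exists>P. finite P \<and> (\<forall>f A C. f \<in> theta_space \<tau> n A C \<longrightarrow> A \<noteq> 0 \<longrightarrow> C \<noteq> 0 \<longrightarrow>
    (\<forall>p\<in>P. f p = 0) \<longrightarrow> (\<forall>z. f z = 0))"
proof -
  have "\<exists>P. finite P \<and> card P = k \<and>
      (\<forall>p\<in>P. \<forall>p'\<in>P. p \<noteq> p' \<longrightarrow> p - p' \<notin> lattice1 \<tau>)" for k
  proof (induction k)
    case (Suc k)
    then obtain P where P: "finite P" "card P = k" "\<forall>p\<in>P. \<forall>p'\<in>P. p \<noteq> p' \<longrightarrow> p - p' \<notin> lattice1 \<tau>"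
      by blast
    have "countable (\<Union>p\<in>P. (\<lambda>l. p + l) ` lattice1 \<tau>)"
      by (intro countable_UN countable_image countable_lattice1 countable_finite P)
    then obtain t where t: "t \<notin> (\<Union>p\<in>P. (\<lambda>l. p + l) ` lattice1 \<tau>)" by (rule avoid_countable)
    have 1: "t - p \<notin> lattice1 \<tau>" if "p \<in> P" for p
    proof
      assume "t - p \<in> lattice1 \<tau>"
      then have "p + (t - p) \<in> (\<lambda>l. p + l) ` lattice1 \<tau>" by (rule imageI)
      with t that show False by auto
    qed
    have 2: "p - t \<notin> lattice1 \<tau>" if "p \<in> P" for p
      using 1[OF that] uminus_in_lattice1[of "p - t" \<tau>] by auto
    have "t \<notin> P" using 1[of t] zero_in_lattice1 by auto
    then show ?case using P 1 2 by (intro exI[of _ "insert t P"]) auto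
  qed auto
  then obtain P where P: "finite P" "card P = Suc n"
    "\<forall>p\<in>P. \<forall>p'\<in>P. p \<noteq> p' \<longrightarrow> p - p' \<notin> lattice1 \<tau>" by blast
  show ?thesis
  proof (intro exI[of _ P] conjI allI impI P(1))
    fix f A C z
    assume "f \<in> theta_space \<tau> n A C" "A \<noteq> 0" "C \<noteq> 0" "\<forall>p\<in>P. f p = 0"
    then show "f z = 0" using theta_space_eq_0[OF \<tau> P(1,2), of f A C z] P(3) by presburger
  qed
qed

text \<open>
  The function is \<open>\<theta>(z + a) \<theta>(z + t)\<^sup>k \<theta>(z + b)\<close> with \<open>k = n - 2\<close> and \<open>a + k t + b = 0\<close>, so that the factors
  which the translations contribute to the multipliers cancel. The first factor
  has a simple zero at \<open>p\<close>; a generic \<open>t\<close> keeps the zeros of the others off \<open>p\<close> and \<open>W\<close>. The bound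
  \<open>n \<ge> 3\<close> gives \<open>k \<ge> 1\<close>: with only two factors, \<open>a\<close> would determine \<open>b\<close>.
\<close>

lemma theta_space_separation:
  assumes \<tau>: "Im \<tau> > 0" and nz: "A \<noteq> 0" "C \<noteq> 0" and n: "n \<ge> 3" and W: "finite W"
  obtains f where "f \<in> theta_space \<tau> n (A ^ n) (C ^ n)" "f p = 0" "deriv f p \<noteq> 0"
    "\<And>w. w \<in> W \<Longrightarrow> w - p \<notin> lattice1 \<tau> \<Longrightarrow> f w \<noteq> 0"
proof -
  obtain \<theta> z0 where \<theta>: "\<theta> \<in> theta_space \<tau> 1 A C"
    and zeros: "\<And>z. \<theta> z = 0 \<longleftrightarrow> z - z0 \<in> lattice1 \<tau>"
    and simple: "\<And>z. \<theta> z = 0 \<Longrightarrow> deriv \<theta> z \<noteq> 0"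
    using theta_space_1_exists[OF \<tau> nz] by blast
  define k where "k = n - 2"
  have k: "k \<ge> 1" "n = 1 + (k + 1)" using n by (auto simp: k_def)
  define a where "a = z0 - p"
  let ?W = "insert p W"
  define B where "B = (\<Union>w\<in>?W. (\<lambda>l. z0 - w + l) ` lattice1 \<tau> \<union>
    (\<lambda>l. (w - a - z0 - l) / of_nat k) ` lattice1 \<tau>)"
  have "countable B"
    unfolding B_def
    by (intro countable_UN countable_Un countable_image countable_lattice1 countable_finite) (use W in auto)
  then obtain t where t: "t \<notin> B" by (rule avoid_countable)
  define b where "b = - a - of_nat k * t"
  define g where "g z = \<theta> (z + t) ^ k * \<theta> (z + b)" for z
  define f where "f z = \<theta> (z + a) * g z" for z
  have gw: "g w \<noteq> 0" if w: "w \<in> ?W" for w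
  proof -
    have "w + t - z0 \<notin> lattice1 \<tau>"
    proof
      assume "w + t - z0 \<in> lattice1 \<tau>"
      then have "z0 - w + (w + t - z0) \<in> (\<lambda>l. z0 - w + l) ` lattice1 \<tau>" by (rule imageI)
      then have "t \<in> (\<lambda>l. z0 - w + l) ` lattice1 \<tau>" by simp
      with t w show False unfolding B_def by blast
    qed
    moreover have "w + b - z0 \<notin> lattice1 \<tau>"
    proof
      assume "w + b - z0 \<in> lattice1 \<tau>"
      then have "(w - a - z0 - (w + b - z0)) / of_nat k \<in>
          (\<lambda>l. (w - a - z0 - l) / of_nat k) ` lattice1 \<tau>" by (rule imageI)
      moreover have "(w - a - z0 - (w + b - z0)) / of_nat k = t" using k by (simp add: b_def)
      ultimately show False using t w unfolding B_def by auto
    qed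
    ultimately show ?thesis by (simp add: g_def zeros)
  qed
  have "(\<lambda>z. \<theta> (z + a) * (\<theta> (z + t) ^ k * \<theta> (z + b))) \<in> theta_space \<tau> (1 + (k * 1 + 1))
      (A * exp (of_nat 1 * kappa \<tau> * a) *
        ((A * exp (of_nat 1 * kappa \<tau> * t)) ^ k * (A * exp (of_nat 1 * kappa \<tau> * b))))
      (C * exp (of_nat 1 * kappa \<tau> * cnj \<tau> * a) *
        ((C * exp (of_nat 1 * kappa \<tau> * cnj \<tau> * t)) ^ k * (C * exp (of_nat 1 * kappa \<tau> * cnj \<tau> * b))))"
    by (intro theta_space_mult theta_space_power theta_space_translate \<theta>)
  moreover have E: "M * exp (x * a) * ((M * exp (x * t)) ^ k * (M * exp (x * b))) = M ^ n" for M x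
  proof -
    have "exp (x * a) * (exp (x * t) ^ k * exp (x * b)) = exp (x * a + of_nat k * (x * t) + x * b)"
      by (simp add: exp_add exp_of_nat_mult)
    also have "x * a + of_nat k * (x * t) + x * b = 0" by (simp add: b_def algebra_simps)
    finally have "exp (x * a) * (exp (x * t) ^ k * exp (x * b)) = 1" by simp
    then have "M * M ^ k * M * (exp (x * a) * (exp (x * t) ^ k * exp (x * b))) = M ^ n"
      by (simp add: k(2))
    then show ?thesis by (simp add: power_mult_distrib mult_ac)
  qed
  ultimately have 1: "f \<in> theta_space \<tau> n (A ^ n) (C ^ n)"
    unfolding f_def[abs_def] g_def E k(2)[symmetric] by (simp add: k(2))
  have \<theta>z0: "\<theta> z0 = 0" using zeros zero_in_lattice1 by simp
  then have 2: "f p = 0" by (simp add: f_def a_def)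
  have \<theta>h: "\<theta> holomorphic_on UNIV" using theta_space_holomorphic[OF \<theta>] .
  have d\<theta>: "((\<lambda>z. \<theta> (z + a)) has_field_derivative deriv \<theta> z0) (at p)"
    using entire_translate_has_deriv[OF \<theta>h, of a p] by (simp add: a_def)
  have "g holomorphic_on UNIV"
    unfolding g_def by (intro holomorphic_intros entire_compose[OF \<theta>h])
  note dg = entire_has_deriv[OF this, of p]
  have "(f has_field_derivative deriv \<theta> z0 * g p) (at p)"
    unfolding f_def by (rule DERIV_cong[OF DERIV_mult[OF d\<theta> dg]]) (simp add: a_def \<theta>z0)
  then have 3: "deriv f p \<noteq> 0" using simple[OF \<theta>z0] gw[of p] by (simp add: DERIV_imp_deriv)
  have 4: "f w \<noteq> 0" if "w \<in> W" "w - p \<notin> lattice1 \<tau>" for w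
    using gw[of w] that by (simp add: f_def zeros a_def)
  show thesis by (rule that[OF 1 2 3 4])
qed

text \<open>
  It suffices to put the prescribed zero of \<open>theta_space_separation\<close> at a point incongruent to all
  points of \<open>W\<close>.
\<close>

lemma theta_space_nonvanishing:
  assumes \<tau>: "Im \<tau> > 0" and nz: "A \<noteq> 0" "C \<noteq> 0" and n: "n \<ge> 3" and W: "finite W"
  obtains f where "f \<in> theta_space \<tau> n (A ^ n) (C ^ n)" "\<And>w. w \<in> W \<Longrightarrow> f w \<noteq> 0"
proof -
  have "countable (\<Union>w\<in>W. (\<lambda>l. w - l) ` lattice1 \<tau>)"
    by (intro countable_UN countable_image countable_lattice1 countable_finite W)
  then obtain p where p: "p \<notin> (\<Union>w\<in>W. (\<lambda>l. w - l) ` lattice1 \<tau>)" by (rule avoid_countable)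
  have *: "w - p \<notin> lattice1 \<tau>" if "w \<in> W" for w
  proof
    assume "w - p \<in> lattice1 \<tau>"
    then have "w - (w - p) \<in> (\<lambda>l. w - l) ` lattice1 \<tau>" by (rule imageI)
    with p that show False by auto
  qed
  show thesis
  proof (rule theta_space_separation[OF \<tau> nz n W, of p])
    fix f assume f: "f \<in> theta_space \<tau> n (A ^ n) (C ^ n)"
      "\<And>w. w \<in> W \<Longrightarrow> w - p \<notin> lattice1 \<tau> \<Longrightarrow> f w \<noteq> 0"
    show thesis by (rule that[OF f(1)]) (intro f(2) *)
  qed
qed

section \<open>Tori and projective spaces\<close>

lemma quotient_map_quotient_topology: "quotient_map X (quotient_topology X q) q"
proof -
  have "{x \<in> topspace X. q x \<in> q ` topspace X} = topspace X" by auto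
  then have "openin (quotient_topology X q) (q ` topspace X)"
    by (simp add: openin_quotient_topology)
  then have "topspace (quotient_topology X q) = q ` topspace X"
    by (metis openin_quotient_topology openin_subset openin_topspace subset_antisym)
  then show ?thesis by (auto simp: quotient_map_def openin_quotient_topology)
qed

lemma topspace_quotient_topology: "topspace (quotient_topology X q) = q ` topspace X"
  using quotient_imp_surjective_map[OF quotient_map_quotient_topology] by metis

lemma torus_proj_coset: "torus_proj L z = {w. w - z \<in> L}"
  by (auto simp: torus_proj_def lattice_rel_def)

lemma torus_eq_range: "torus L = range (torus_proj L)"
  by (auto simp: torus_def torus_proj_def quotient_def)

lemma topspace_torus: "topspace (torus_topology L) = torus L"
  by (simp add: torus_topology_def topspace_quotient_topology torus_eq_range)

locale additive_subgroup =
  fixes L :: "(complex ^ 2) set"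
  assumes zero: "0 \<in> L" and add: "x \<in> L \<Longrightarrow> y \<in> L \<Longrightarrow> x + y \<in> L"
    and uminus: "x \<in> L \<Longrightarrow> - x \<in> L"
begin

lemma torus_proj_eq_iff: "torus_proj L z = torus_proj L w \<longleftrightarrow> w - z \<in> L"
proof
  assume "torus_proj L z = torus_proj L w"
  moreover have "w \<in> torus_proj L w" using zero by (simp add: torus_proj_coset)
  ultimately have "w \<in> torus_proj L z" by simp
  then show "w - z \<in> L" by (simp add: torus_proj_coset)
next
  assume *: "w - z \<in> L"
  have "x - z \<in> L \<longleftrightarrow> x - w \<in> L" for x
    using add[OF _ *, of "x - w"] add[OF _ uminus[OF *], of "x - z"] by (simp add: algebra_simps) blast
  then show "torus_proj L z = torus_proj L w" by (simp add: torus_proj_coset)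
qed

lemma compact_torus:
  assumes "compact K" and K: "\<And>z. \<exists>w\<in>K. z - w \<in> L"
  shows "compact_space (torus_topology L)"
proof -
  have "continuous_map euclidean (torus_topology L) (torus_proj L)"
    unfolding torus_topology_def
    by (rule quotient_imp_continuous_map[OF quotient_map_quotient_topology])
  then have "compactin (torus_topology L) (torus_proj L ` K)"
    using \<open>compact K\<close> by (intro image_compactin[of euclidean]) simp
  moreover have "torus_proj L ` K = torus L"
  proof (intro equalityI subsetI)
    fix a assume "a \<in> torus L"
    then obtain z where "a = torus_proj L z" by (auto simp: torus_eq_range)
    moreover obtain w where "w \<in> K" "z - w \<in> L" using K by blast
    ultimately show "a \<in> torus_proj L ` K" using torus_proj_eq_iff[of w z] by auto
  qed (auto simp: torus_eq_range)
  ultimately show ?thesis by (simp add: compact_space_def topspace_torus)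
qed

end

lemma proj_class_eq_iff: "proj_class v = proj_class w \<longleftrightarrow> (\<exists>c. c \<noteq> 0 \<and> w = (\<lambda>j. c * v j))"
proof
  assume "proj_class v = proj_class w"
  moreover have "w \<in> proj_class w"
    by (auto simp: proj_class_def proj_rel_def intro!: exI[of _ 1])
  ultimately have "w \<in> proj_class v" by simp
  then show "\<exists>c. c \<noteq> 0 \<and> w = (\<lambda>j. c * v j)" by (auto simp: proj_class_def proj_rel_def)
next
  assume "\<exists>c. c \<noteq> 0 \<and> w = (\<lambda>j. c * v j)"
  then obtain c where c: "c \<noteq> 0" "w = (\<lambda>j. c * v j)" by blast
  have "(\<exists>d. d \<noteq> 0 \<and> x = (\<lambda>j. d * v j)) \<longleftrightarrow> (\<exists>d. d \<noteq> 0 \<and> x = (\<lambda>j. d * w j))" for x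
  proof
    assume "\<exists>d. d \<noteq> 0 \<and> x = (\<lambda>j. d * v j)"
    then obtain d where "d \<noteq> 0" "x = (\<lambda>j. d * v j)" by blast
    then show "\<exists>d. d \<noteq> 0 \<and> x = (\<lambda>j. d * w j)" using c by (intro exI[of _ "d / c"]) auto
  next
    assume "\<exists>d. d \<noteq> 0 \<and> x = (\<lambda>j. d * w j)"
    then obtain d where "d \<noteq> 0" "x = (\<lambda>j. d * w j)" by blast
    then show "\<exists>d. d \<noteq> 0 \<and> x = (\<lambda>j. d * v j)" using c by (intro exI[of _ "d * c"]) (auto simp: mult.assoc)
  qed
  then show "proj_class v = proj_class w" by (auto simp: proj_class_def proj_rel_def)
qed

lemma topspace_proj: "topspace (proj_topology m) = proj_class ` cvec_nonzero m"
  by (simp add: proj_topology_def topspace_quotient_topology)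

text \<open>
  The matrix of the orthogonal projection onto the line through \<open>v\<close>. It depends only on that line, and
  continuously, so it embeds projective space into a Hausdorff space.
\<close>

definition projector :: "nat \<Rightarrow> (nat \<Rightarrow> complex) \<Rightarrow> nat \<times> nat \<Rightarrow> complex" where
  "projector m v = (\<lambda>(i, j). v i * cnj (v j) / of_real (\<Sum>k<m. (norm (v k))\<^sup>2))"

lemma cvec_norm_pos:
  assumes "v \<in> cvec_nonzero m"
  shows "(\<Sum>k<m. (norm (v k))\<^sup>2) > 0"
proof -
  obtain j where j: "v j \<noteq> 0" using assms by (auto simp: cvec_nonzero_def fun_eq_iff)
  then have "j < m" using assms by (force simp: cvec_nonzero_def cvec_def)
  then show ?thesis using j by (intro sum_pos2[of _ j]) auto
qed

lemma continuous_projector: "continuous_on (cvec_nonzero m) (projector m)"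
proof (rule continuous_on_coordinatewise_then_product)
  fix p :: "nat \<times> nat"
  obtain i j where p: "p = (i, j)" by (cases p)
  have c: "continuous_on S (\<lambda>v. v k :: complex)" for k :: nat and S
    by (rule continuous_on_subset[OF continuous_on_product_coordinates]) auto
  show "continuous_on (cvec_nonzero m) (\<lambda>v. projector m v p)"
    unfolding projector_def p prod.case
    by (intro continuous_intros c) (use cvec_norm_pos in \<open>metis less_irrefl of_real_eq_0_iff\<close>)
qed

lemma projector_scale: "c \<noteq> 0 \<Longrightarrow> projector m (\<lambda>j. c * v j) = projector m v"
proof -
  assume c: "c \<noteq> 0"
  have "projector m (\<lambda>j. c * v j) (i, j) = projector m v (i, j)" for i j
  proof -
    have n: "complex_of_real (\<Sum>k<m. (norm (c * v k))\<^sup>2) =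
        (c * cnj c) * of_real (\<Sum>k<m. (norm (v k))\<^sup>2)"
      unfolding complex_norm_square[symmetric] of_real_mult[symmetric]
      by (simp only: norm_mult power_mult_distrib sum_distrib_left)
    have "c * v i * cnj (c * v j) = (c * cnj c) * (v i * cnj (v j))" by simp
    then show ?thesis unfolding projector_def prod.case n using c by simp
  qed
  then show ?thesis by (simp add: fun_eq_iff)
qed

lemma projector_inj:
  assumes v: "v \<in> cvec_nonzero m" and w: "w \<in> cvec_nonzero m" and eq: "projector m v = projector m w"
  shows "proj_class v = proj_class w"
proof -
  define a where "a = complex_of_real (\<Sum>k<m. (norm (v k))\<^sup>2)"
  define b where "b = complex_of_real (\<Sum>k<m. (norm (w k))\<^sup>2)"
  have ab: "a \<noteq> 0" "b \<noteq> 0"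
    using cvec_norm_pos[OF v] cvec_norm_pos[OF w] unfolding a_def b_def of_real_eq_0_iff by auto
  have e: "v i * cnj (v j) / a = w i * cnj (w j) / b" for i j
    using fun_cong[OF eq, of "(i, j)"] by (simp only: projector_def prod.case a_def b_def)
  obtain j where j: "v j \<noteq> 0" using v by (auto simp: cvec_nonzero_def fun_eq_iff)
  have wj: "w j \<noteq> 0" using e[of j j] j ab by auto
  \<comment> \<open>The \<open>j\<close>-th column of the projector of \<open>v\<close> is a nonzero multiple of \<open>v\<close>.\<close>
  define c where "c = b * cnj (v j) / (a * cnj (w j))"
  have "w i = c * v i" for i
    using e[of i j] ab wj by (simp add: c_def field_simps)
  moreover have "c \<noteq> 0" using ab j wj by (simp add: c_def)
  ultimately show ?thesis unfolding proj_class_eq_iff by blast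
qed

lemma Hausdorff_proj: "Hausdorff_space (proj_topology m)"
proof -
  define F where "F p = projector m (SOME v. v \<in> cvec_nonzero m \<and> proj_class v = p)" for p
  have F: "F (proj_class v) = projector m v" if v: "v \<in> cvec_nonzero m" for v
  proof -
    let ?w = "SOME w. w \<in> cvec_nonzero m \<and> proj_class w = proj_class v"
    have "proj_class ?w = proj_class v"
      using someI[of "\<lambda>w. w \<in> cvec_nonzero m \<and> proj_class w = proj_class v" v] v by simp
    then obtain c where "c \<noteq> 0" "v = (\<lambda>j. c * ?w j)" unfolding proj_class_eq_iff by blast
    then show ?thesis unfolding F_def using projector_scale[of c m ?w] by simp
  qed
  have "continuous_map (top_of_set (cvec_nonzero m)) euclidean (F \<circ> proj_class)"
    by (rule continuous_map_eq[of _ _ "projector m"]) (use continuous_projector in \<open>auto simp: F\<close>)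
  then have "continuous_map (proj_topology m) euclidean F"
    unfolding proj_topology_def
    by (rule continuous_compose_quotient_map[OF quotient_map_quotient_topology])
  moreover have "inj_on F (topspace (proj_topology m))"
  proof (rule inj_onI)
    fix p q assume p: "p \<in> topspace (proj_topology m)" and q: "q \<in> topspace (proj_topology m)"
      and eq: "F p = F q"
    obtain v where v: "v \<in> cvec_nonzero m" "p = proj_class v" using p unfolding topspace_proj by auto
    obtain w where w: "w \<in> cvec_nonzero m" "q = proj_class w" using q unfolding topspace_proj by auto
    have "projector m v = projector m w" using eq F v w by metis
    with v w show "p = q" using projector_inj by metis
  qed
  ultimately show ?thesis by (intro Hausdorff_space_injective_preimage[OF Hausdorff_space_euclidean])
qed

section \<open>Projective embeddings from separating sections\<close>

lemma has_complex_derivative_unique: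
  "has_complex_derivative f D z \<Longrightarrow> has_complex_derivative f D' z \<Longrightarrow> D = D'"
  by (auto simp: has_complex_derivative_def intro: has_derivative_unique)

lemma has_complex_derivative_scaled_sum:
  assumes "\<And>j. j \<in> I \<Longrightarrow> has_complex_derivative (f j) (D j) z"
  shows "has_complex_derivative (\<lambda>z. \<Sum>j\<in>I. c j * f j z) (\<lambda>v. \<Sum>j\<in>I. c j * D j v) z"
  using assms
  by (auto simp: has_complex_derivative_def sum_distrib_left mult_ac
      intro!: has_derivative_sum has_derivative_mult_right sum.cong)

lemma has_complex_derivative_mult:
  assumes "has_complex_derivative f D z" "has_complex_derivative g E z"
  shows "has_complex_derivative (\<lambda>z. f z * g z) (\<lambda>v. f z * E v + D v * g z) z"
  unfolding has_complex_derivative_def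
proof
  show "((\<lambda>z. f z * g z) has_derivative (\<lambda>v. f z * E v + D v * g z)) (at z)"
    using assms by (intro has_derivative_mult) (auto simp: has_complex_derivative_def)
qed (use assms in \<open>auto simp: has_complex_derivative_def algebra_simps\<close>)

lemma has_complex_derivative_divide:
  assumes "has_complex_derivative f D z" "has_complex_derivative g E z" "g z \<noteq> 0"
  shows "has_complex_derivative (\<lambda>z. f z / g z) (\<lambda>v. (D v * g z - f z * E v) / (g z * g z)) z"
  unfolding has_complex_derivative_def
proof
  show "((\<lambda>z. f z / g z) has_derivative (\<lambda>v. (D v * g z - f z * E v) / (g z * g z))) (at z)"
    using assms by (intro has_derivative_divide') (auto simp: has_complex_derivative_def)
qed (use assms in \<open>auto simp: has_complex_derivative_def algebra_simps diff_divide_distrib\<close>)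

lemma entire2_continuous: "entire2 f \<Longrightarrow> continuous_on UNIV f"
  unfolding entire2_def has_complex_derivative_def
  by (meson continuous_at_imp_continuous_on has_derivative_continuous)

lemma span_list_expansion:
  assumes "f \<in> cfun.span (set bs)"
  shows "\<exists>c. \<forall>z. f z = (\<Sum>j<length bs. c j * (bs ! j) z)"
  using assms
proof (induction rule: cfun.span_induct_alt)
  case base
  show ?case by (intro exI[of _ "\<lambda>_. 0"]) simp
next
  case (step a x y)
  then obtain c where c: "\<And>z. y z = (\<Sum>j<length bs. c j * (bs ! j) z)" by auto
  obtain i where i: "i < length bs" "x = bs ! i" using step(1) by (auto simp: in_set_conv_nth)
  have "a * x z + y z = (\<Sum>j<length bs. ((if j = i then a else 0) + c j) * (bs ! j) z)" for z
    using i by (simp add: c distrib_right sum.distrib if_distrib[of "\<lambda>t. t * _"] cong: if_cong)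
  then show ?case by (intro exI[of _ "\<lambda>j. (if j = i then a else 0) + c j"]) simp
qed

text \<open>
  The induced map is continuous and injective from a compact to a Hausdorff space, hence a closed
  topological embedding. All hypotheses concern the space spanned by the basis, so no particular
  basis has to be known: in an affine chart, a tangent vector killed by all coordinate quotients
  is killed by every section that vanishes at the point, and \<open>tangents\<close> excludes this.
\<close>

theorem (in additive_subgroup) separating_sections_embed:
  fixes bs :: "(complex ^ 2 \<Rightarrow> complex) list"
  defines "V \<equiv> cfun.span (set bs)"
  assumes cpt: "compact_space (torus_topology L)"
    and entire: "\<And>f. f \<in> V \<Longrightarrow> entire2 f"
    and J: "\<And>\<alpha> z. \<alpha> \<in> L \<Longrightarrow> J \<alpha> z \<noteq> 0"
    and quasi: "\<And>f \<alpha> z. f \<in> V \<Longrightarrow> \<alpha> \<in> L \<Longrightarrow> f (z + \<alpha>) = J \<alpha> z * f z"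
    and nonvanishing: "\<And>z. \<exists>f\<in>V. f z \<noteq> 0"
    and points: "\<And>z w. w - z \<notin> L \<Longrightarrow> \<exists>f\<in>V. f z = 0 \<and> f w \<noteq> 0"
    and tangents: "\<And>z v. v \<noteq> 0 \<Longrightarrow>
      \<exists>f\<in>V. f z = 0 \<and> (\<exists>D. has_complex_derivative f D z \<and> D v \<noteq> 0)"
  shows "\<exists>\<phi>. (\<forall>z. eval_list bs z \<noteq> (\<lambda>_. 0) \<and> \<phi> (torus_proj L z) = proj_class (eval_list bs z)) \<and>
    closed_holomorphic_embedding L (length bs) \<phi>"
proof -
  let ?m = "length bs" and ?s = "eval_list bs"
  have bsV: "bs ! j \<in> V" if "j < ?m" for j
    unfolding V_def using that by (intro cfun.span_base) auto
  have expand: "\<exists>c. \<forall>z. f z = (\<Sum>j<?m. c j * ?s z j)" if "f \<in> V" for f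
    using span_list_expansion[OF that[unfolded V_def]] by (simp add: eval_list_def)
  have s0: "?s z \<noteq> (\<lambda>_. 0)" for z
  proof
    assume "?s z = (\<lambda>_. 0)"
    then have "f z = 0" if "f \<in> V" for f using expand[OF that] by auto
    with nonvanishing[of z] show False by blast
  qed
  have sV: "?s z \<in> cvec_nonzero ?m" for z
    using s0 by (auto simp: cvec_nonzero_def cvec_def eval_list_def)
  have sL: "proj_class (?s w) = proj_class (?s z)" if "w - z \<in> L" for z w
  proof -
    have "?s w = (\<lambda>j. J (w - z) z * ?s z j)"
      using quasi[OF bsV that, of _ z] by (auto simp: eval_list_def fun_eq_iff)
    then show ?thesis using J[OF that] proj_class_eq_iff by metis
  qed
  \<comment> \<open>By \<open>sL\<close> the choice of a representative is immaterial.\<close>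
  define \<phi> where "\<phi> a = proj_class (?s (SOME z. z \<in> a))" for a :: "(complex ^ 2) set"
  have \<phi>: "\<phi> (torus_proj L z) = proj_class (?s z)" for z
  proof -
    have "z \<in> torus_proj L z" using zero by (simp add: torus_proj_coset)
    then have "(SOME w. w \<in> torus_proj L z) \<in> torus_proj L z" by (rule someI)
    then show ?thesis unfolding \<phi>_def by (intro sL) (simp add: torus_proj_coset)
  qed
  have "continuous_map euclidean (top_of_set (cvec_nonzero ?m)) ?s"
  proof -
    have "continuous_on UNIV ?s"
    proof (rule continuous_on_coordinatewise_then_product)
      show "continuous_on UNIV (\<lambda>z. ?s z j)" for j
        using entire2_continuous[OF entire[OF bsV]] by (cases "j < ?m") (auto simp: eval_list_def)
    qed
    then show ?thesis using sV by (auto simp: continuous_map_in_subtopology)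
  qed
  moreover have "continuous_map (top_of_set (cvec_nonzero ?m)) (proj_topology ?m) proj_class"
    unfolding proj_topology_def by (rule quotient_imp_continuous_map[OF quotient_map_quotient_topology])
  ultimately have "continuous_map euclidean (proj_topology ?m) (proj_class \<circ> ?s)"
    by (rule continuous_map_compose)
  then have "continuous_map euclidean (proj_topology ?m) (\<phi> \<circ> torus_proj L)"
    by (simp add: o_def \<phi>)
  then have cont: "continuous_map (torus_topology L) (proj_topology ?m) \<phi>"
    unfolding torus_topology_def
    by (rule continuous_compose_quotient_map[OF quotient_map_quotient_topology])
  have closed: "closed_map (torus_topology L) (proj_topology ?m) \<phi>"
    by (rule continuous_imp_closed_map[OF cont cpt Hausdorff_proj])
  have "w - z \<in> L" if eq: "proj_class (?s z) = proj_class (?s w)" for z w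
  proof (rule ccontr)
    assume "w - z \<notin> L"
    then obtain f where f: "f \<in> V" "f z = 0" "f w \<noteq> 0" using points by blast
    obtain c where c: "\<And>z. f z = (\<Sum>j<?m. c j * ?s z j)" using expand[OF f(1)] by blast
    obtain d where "?s w = (\<lambda>j. d * ?s z j)" using eq unfolding proj_class_eq_iff by blast
    then have "f w = d * f z" by (simp add: c sum_distrib_left mult_ac)
    with f show False by simp
  qed
  then have inj: "inj_on \<phi> (topspace (torus_topology L))"
    by (auto simp: inj_on_def topspace_torus torus_eq_range \<phi> torus_proj_eq_iff)
  have emb: "embedding_map (torus_topology L) (proj_topology ?m) \<phi>"
    by (rule injective_closed_imp_embedding_map[OF cont closed inj])
  have cl: "closedin (proj_topology ?m) (\<phi> ` torus L)"
    using closed unfolding closed_map_def by (metis closedin_topspace topspace_torus)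
  have imm: "\<exists>D. (\<forall>j<?m. has_complex_derivative (\<lambda>w. affine_coord i j (\<phi> (torus_proj L w))) (D j) z) \<and>
             (\<forall>v. (\<forall>j<?m. D j v = 0) \<longrightarrow> v = 0)"
    if i: "i < ?m" and dom: "\<phi> (torus_proj L z) \<in> affine_domain ?m i" for z i
  proof -
    have "?s z \<in> proj_class (?s z)"
      by (auto simp: proj_class_def proj_rel_def intro!: exI[of _ 1])
    then have si: "?s z i \<noteq> 0" using dom by (auto simp: affine_domain_def \<phi>)
    have "\<exists>D. has_complex_derivative (\<lambda>w. ?s w j) D z" if "j < ?m" for j
      using entire[OF bsV[OF that]] that by (simp add: entire2_def eval_list_def)
    then obtain E where E: "\<And>j. j < ?m \<Longrightarrow> has_complex_derivative (\<lambda>w. ?s w j) (E j) z" by metis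
    \<comment> \<open>The quotient rule for the affine coordinates.\<close>
    define D where "D j v = (E j v * ?s z i - ?s z j * E i v) / (?s z i * ?s z i)" for j v
    have 1: "has_complex_derivative (\<lambda>w. affine_coord i j (\<phi> (torus_proj L w))) (D j) z"
      if "j < ?m" for j
      unfolding \<phi> affine_coord_proj_class D_def
      by (rule has_complex_derivative_divide[OF E[OF that] E[OF i] si])
    have 2: "v = 0" if v: "\<forall>j<?m. D j v = 0" for v
    proof (rule ccontr)
      assume "v \<noteq> 0"
      then obtain f F where f: "f \<in> V" "f z = 0" "has_complex_derivative f F z" "F v \<noteq> 0"
        using tangents by blast
      obtain c where c: "\<And>z. f z = (\<Sum>j<?m. c j * ?s z j)" using expand[OF f(1)] by blast
      have "has_complex_derivative f (\<lambda>v. \<Sum>j<?m. c j * E j v) z"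
        unfolding c by (rule has_complex_derivative_scaled_sum) (use E in simp)
      then have "F v = (\<Sum>j<?m. c j * E j v)"
        using has_complex_derivative_unique[OF f(3)] by simp
      also have "\<dots> = (\<Sum>j<?m. c j * ?s z j * (E i v / ?s z i))"
      proof (rule sum.cong)
        fix j assume "j \<in> {..<?m}"
        then have "E j v * ?s z i = ?s z j * E i v" using v si by (simp add: D_def)
        then have "E j v = ?s z j * E i v / ?s z i" using si by (simp add: field_simps)
        then show "c j * E j v = c j * ?s z j * (E i v / ?s z i)" by simp
      qed simp
      also have "\<dots> = f z * (E i v / ?s z i)" unfolding c by (simp only: sum_distrib_right)
      finally show False using f by simp
    qed
    show ?thesis using 1 2 by blast
  qed
  show ?thesis
    unfolding closed_holomorphic_embedding_def
    by (intro exI[of _ \<phi>] conjI allI impI s0 \<phi> emb cl imm)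
qed

section \<open>Entire functions of two variables\<close>

definition pair_vec :: "complex \<Rightarrow> complex \<Rightarrow> complex ^ 2" where
  "pair_vec a b = (\<chi> i. if i = 1 then a else b)"

lemma pair_vec_nth [simp]: "pair_vec a b $ 1 = a" "pair_vec a b $ 2 = b"
  by (simp_all add: pair_vec_def)

lemma vec2_eq_iff: "z = w \<longleftrightarrow> z $ 1 = w $ 1 \<and> z $ 2 = w $ 2" for z w :: "complex ^ 2"
  by (simp add: vec_eq_iff forall_2)

lemma pair_vec_eta [simp]: "pair_vec (z $ 1) (z $ 2) = z"
  by (simp add: vec2_eq_iff)

lemma pair_vec_add: "pair_vec a b + pair_vec c d = pair_vec (a + c) (b + d)"
  by (simp add: vec2_eq_iff)

lemma bounded_linear_pair_vec:
  "bounded_linear (\<lambda>a. pair_vec a 0)" "bounded_linear (\<lambda>b. pair_vec 0 b)"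
  by (auto intro!: linear_conv_bounded_linear[THEN iffD1] linearI simp: vec2_eq_iff)

lemma holomorphic_slices:
  assumes "entire2 f"
  shows "(\<lambda>a. f (pair_vec a b)) holomorphic_on UNIV" "(\<lambda>b. f (pair_vec a b)) holomorphic_on UNIV"
proof -
  have key: "(\<lambda>x. f (l x + c)) holomorphic_on UNIV"
    if l: "bounded_linear l" and lin: "\<And>h. l h = h *s l 1" for l and c :: "complex ^ 2"
  proof -
    have "\<exists>d. ((\<lambda>x. f (l x + c)) has_field_derivative d) (at x)" for x
    proof -
      obtain D where D: "(f has_derivative D) (at (l x + c))" "\<And>k v. D (k *s v) = k * D v"
        using assms unfolding entire2_def has_complex_derivative_def by blast
      have "((\<lambda>x. l x + c) has_derivative l) (at x)"
        using has_derivative_add[OF bounded_linear_imp_has_derivative[OF l] has_derivative_const] by simp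
      then have "((\<lambda>x. f (l x + c)) has_derivative (\<lambda>h. D (l h))) (at x)"
        using has_derivative_compose[of "\<lambda>x. l x + c" l x UNIV f D] D(1) by simp
      moreover have "(\<lambda>h. D (l h)) = (*) (D (l 1))"
      proof
        show "D (l h) = D (l 1) * h" for h using lin[of h] D(2)[of h "l 1"] by simp
      qed
      ultimately show ?thesis unfolding has_field_derivative_def by metis
    qed
    then show ?thesis by (simp add: holomorphic_on_open)
  qed
  have "(\<lambda>a. f (pair_vec a 0 + pair_vec 0 b)) holomorphic_on UNIV"
    by (rule key[OF bounded_linear_pair_vec(1)]) (simp add: vec2_eq_iff)
  then show "(\<lambda>a. f (pair_vec a b)) holomorphic_on UNIV" by (simp add: pair_vec_add)
  have "(\<lambda>b. f (pair_vec 0 b + pair_vec a 0)) holomorphic_on UNIV"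
    by (rule key[OF bounded_linear_pair_vec(2)]) (simp add: vec2_eq_iff)
  then show "(\<lambda>b. f (pair_vec a b)) holomorphic_on UNIV" by (simp add: pair_vec_add)
qed

lemma has_complex_derivative_coordinate:
  assumes "f holomorphic_on UNIV"
  shows "has_complex_derivative (\<lambda>z. f (z $ i)) (\<lambda>v. deriv f (z $ i) * v $ i) z"
  unfolding has_complex_derivative_def
proof
  have "(f has_derivative (*) (deriv f (z $ i))) (at (z $ i))"
    using holomorphic_derivI[OF assms, of "z $ i"] by (simp add: has_field_derivative_def)
  moreover have "((\<lambda>z. z $ i) has_derivative (\<lambda>v. v $ i)) (at z)"
    by (rule bounded_linear_imp_has_derivative[OF bounded_linear_vec_nth])
  ultimately show "((\<lambda>z. f (z $ i)) has_derivative (\<lambda>v. deriv f (z $ i) * v $ i)) (at z)"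
    using has_derivative_compose[of "\<lambda>z. z $ i" "\<lambda>v. v $ i" z UNIV f] by simp
qed simp

lemma has_complex_derivative_split_product:
  assumes "f holomorphic_on UNIV" "g holomorphic_on UNIV"
  shows "has_complex_derivative (\<lambda>z. f (z $ 1) * g (z $ 2))
    (\<lambda>v. f (z $ 1) * (deriv g (z $ 2) * v $ 2) + deriv f (z $ 1) * v $ 1 * g (z $ 2)) z"
  using has_complex_derivative_mult[OF has_complex_derivative_coordinate[OF assms(1)]
      has_complex_derivative_coordinate[OF assms(2)]] .

lemma entire2_split_product:
  assumes "f holomorphic_on UNIV" "g holomorphic_on UNIV"
  shows "entire2 (\<lambda>z. f (z $ 1) * g (z $ 2))"
  unfolding entire2_def using has_complex_derivative_split_product[OF assms] by blast

lemma entire2_add: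
  assumes "entire2 f" "entire2 g"
  shows "entire2 (\<lambda>z. f z + g z)"
  unfolding entire2_def
proof
  fix z
  obtain D E where "has_complex_derivative f D z" "has_complex_derivative g E z"
    using assms unfolding entire2_def by blast
  then have "has_complex_derivative (\<lambda>z. f z + g z) (\<lambda>v. D v + E v) z"
    by (auto simp: has_complex_derivative_def algebra_simps intro: has_derivative_add)
  then show "\<exists>D. has_complex_derivative (\<lambda>z. f z + g z) D z" by blast
qed

lemma entire2_scale:
  assumes "entire2 f"
  shows "entire2 (\<lambda>z. c * f z)"
  unfolding entire2_def
proof
  fix z
  obtain D where "has_complex_derivative f D z" using assms unfolding entire2_def by blast
  then have "has_complex_derivative (\<lambda>z. c * f z) (\<lambda>v. c * D v) z"
    by (auto simp: has_complex_derivative_def intro: has_derivative_mult_right)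
  then show "\<exists>D. has_complex_derivative (\<lambda>z. c * f z) D z" by blast
qed

text \<open>
  A space of functions has dimension at most the number of points that determine its elements. By
  induction: the functions of \<open>V\<close> that vanish at \<open>p\<close> are determined by the remaining points and form
  all of \<open>V\<close> or a hyperplane, which needs one more generator.
\<close>

lemma finite_spanning_set_of_determining_points:
  assumes "finite P" and "cfun.subspace V" and "\<And>f. f \<in> V \<Longrightarrow> (\<And>p. p \<in> P \<Longrightarrow> f p = 0) \<Longrightarrow> f = 0"
  shows "\<exists>B. finite B \<and> B \<subseteq> V \<and> V \<subseteq> cfun.span B"
  using assms
proof (induction P arbitrary: V rule: finite_induct)
  case empty
  have "V \<subseteq> cfun.span {}"
  proof
    fix f assume "f \<in> V"
    then have "f = 0" by (rule empty.prems(2)) simp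
    then show "f \<in> cfun.span {}" by (simp add: cfun.span_zero)
  qed
  then show ?case by blast
next
  case (insert p P)
  note V = insert.prems(1)
  define V' where "V' = {f \<in> V. f p = 0}"
  have V': "cfun.subspace V'"
    unfolding V'_def
    by (intro cfun.subspaceI)
      (use cfun.subspace_0[OF V] cfun.subspace_add[OF V] cfun.subspace_scale[OF V] in auto)
  have "f = 0" if "f \<in> V'" "\<And>q. q \<in> P \<Longrightarrow> f q = 0" for f
    by (rule insert.prems(2)) (use that in \<open>auto simp: V'_def\<close>)
  then obtain B where B: "finite B" "B \<subseteq> V'" "V' \<subseteq> cfun.span B"
    using insert.IH[OF V'] by blast
  show ?case
  proof (cases "V' = V")
    case True
    then show ?thesis using B by blast
  next
    case False
    then obtain g where g: "g \<in> V" "g p \<noteq> 0" by (auto simp: V'_def)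
    have "f \<in> cfun.span (insert g B)" if f: "f \<in> V" for f
    proof -
      define c where "c = f p / g p"
      have "f - (\<lambda>z. c * g z) \<in> V"
        by (rule cfun.subspace_diff[OF V f cfun.subspace_scale[OF V g(1)]])
      then have "f - (\<lambda>z. c * g z) \<in> cfun.span B"
        using B(3) g by (auto simp: V'_def c_def)
      then show ?thesis unfolding cfun.span_insert by blast
    qed
    then show ?thesis using B g by (intro exI[of _ "insert g B"]) (auto simp: V'_def)
  qed
qed

lemma basis_of_determining_points:
  assumes "finite P" and V: "cfun.subspace V"
    and "\<And>f. f \<in> V \<Longrightarrow> (\<And>p. p \<in> P \<Longrightarrow> f p = 0) \<Longrightarrow> f = 0"
  shows "\<exists>bs. is_basis V bs"
proof -
  obtain B where B: "finite B" "B \<subseteq> V" "V \<subseteq> cfun.span B"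
    using finite_spanning_set_of_determining_points[OF assms] by blast
  obtain C where C: "C \<subseteq> B" "cfun.independent C" "B \<subseteq> cfun.span C"
    by (rule cfun.maximal_independent_subset)
  obtain bs where bs: "set bs = C" "distinct bs"
    using finite_distinct_list[OF finite_subset[OF C(1) B(1)]] by blast
  have "cfun.span C \<subseteq> V" using C(1) B(2) V by (intro cfun.span_minimal) auto
  moreover have "V \<subseteq> cfun.span C"
    using B(3) cfun.span_mono[OF C(3)] by (simp add: cfun.span_span)
  ultimately show ?thesis using bs C(2) by (intro exI[of _ bs]) (auto simp: is_basis_def)
qed

section \<open>The period lattice and the Hermitian form\<close>

lemma L_tau_eq: "L_tau \<tau> = {z. z $ 1 \<in> lattice1 \<tau> \<and> z $ 2 \<in> lattice1 \<tau>}"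
proof (intro equalityI subsetI)
  have nth: "(a v* Omega_tau \<tau> + b) $ i = a $ i * \<tau> + b $ i" for a b i
    using exhaust_2[of i]
    by (auto simp: Omega_tau_def vector_matrix_mult_def sum_2 vector_2)
  fix z :: "complex ^ 2"
  {
    assume "z \<in> L_tau \<tau>"
    then obtain a b where z: "z = a v* Omega_tau \<tau> + b" "a \<in> int_rows" "b \<in> int_rows"
      by (auto simp: L_tau_def period_lattice_def)
    have "z $ i \<in> lattice1 \<tau>" for i
    proof -
      obtain m n where "a $ i = of_int m" "b $ i = of_int n"
        using z(2,3) by (metis (mono_tags, lifting) Ints_cases int_rows_def mem_Collect_eq)
      then show ?thesis unfolding z(1) nth lattice1_def by auto
    qed
    then show "z \<in> {z. z $ 1 \<in> lattice1 \<tau> \<and> z $ 2 \<in> lattice1 \<tau>}" by simp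
  next
    assume "z \<in> {z. z $ 1 \<in> lattice1 \<tau> \<and> z $ 2 \<in> lattice1 \<tau>}"
    then obtain m n m' n' where z: "z $ 1 = of_int m * \<tau> + of_int n" "z $ 2 = of_int m' * \<tau> + of_int n'"
      by (auto simp: lattice1_def)
    have "z = pair_vec (of_int m) (of_int m') v* Omega_tau \<tau> + pair_vec (of_int n) (of_int n')"
      unfolding vec2_eq_iff nth by (simp add: z)
    moreover have "pair_vec (of_int k) (of_int l) \<in> int_rows" for k l
      by (simp add: int_rows_def forall_2)
    ultimately show "z \<in> L_tau \<tau>" unfolding L_tau_def period_lattice_def by blast
  }
qed

lemma pair_vec_in_L_tau: "pair_vec a b \<in> L_tau \<tau> \<longleftrightarrow> a \<in> lattice1 \<tau> \<and> b \<in> lattice1 \<tau>"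
  by (simp add: L_tau_eq)

lemma additive_subgroup_L_tau: "additive_subgroup (L_tau \<tau>)"
  by unfold_locales
    (auto simp: L_tau_eq zero_in_lattice1 add_in_lattice1 uminus_in_lattice1)

lemma compact_torus_tau:
  assumes "Im \<tau> > 0"
  shows "compact_space (torus_topology (L_tau \<tau>))"
proof (rule additive_subgroup.compact_torus[OF additive_subgroup_L_tau])
  let ?Q = "parallelogram \<tau> \<times> parallelogram \<tau>"
  have "continuous_on ?Q (\<lambda>p. pair_vec (fst p) 0 + pair_vec 0 (snd p))"
    by (intro continuous_intros bounded_linear.continuous_on[OF bounded_linear_pair_vec(1)]
        bounded_linear.continuous_on[OF bounded_linear_pair_vec(2)])
  then show "compact ((\<lambda>p. pair_vec (fst p) 0 + pair_vec 0 (snd p)) ` ?Q)"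
    by (intro compact_continuous_image compact_Times compact_parallelogram)
  show "\<exists>w\<in>(\<lambda>p. pair_vec (fst p) 0 + pair_vec 0 (snd p)) ` ?Q. z - w \<in> L_tau \<tau>" for z
  proof -
    obtain a k where a: "a \<in> parallelogram \<tau>" "k \<in> lattice1 \<tau>" "z $ 1 = a + k"
      using parallelogram_reduction[of \<tau> "z $ 1"] assms by auto
    obtain b l where b: "b \<in> parallelogram \<tau>" "l \<in> lattice1 \<tau>" "z $ 2 = b + l"
      using parallelogram_reduction[of \<tau> "z $ 2"] assms by auto
    have "z - (pair_vec a 0 + pair_vec 0 b) = pair_vec k l" by (simp add: vec2_eq_iff a b)
    then have "z - (pair_vec a 0 + pair_vec 0 b) \<in> L_tau \<tau>"
      using a b by (simp add: pair_vec_in_L_tau)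
    then show ?thesis using a(1) b(1) by (intro bexI[of _ "pair_vec a 0 + pair_vec 0 b"]) force+
  qed
qed

lemma Im_lattice1_form:
  assumes "Im \<tau> \<noteq> 0" "a \<in> lattice1 \<tau>" "b \<in> lattice1 \<tau>"
  shows "Im (a * cnj b) / Im \<tau> \<in> \<int>"
proof -
  obtain m n where a: "a = of_int m * \<tau> + of_int n" using assms by (auto simp: lattice1_def)
  obtain k l where b: "b = of_int k * \<tau> + of_int l" using assms by (auto simp: lattice1_def)
  have "Im (a * cnj b) = (of_int (m * l - n * k)) * Im \<tau>"
    by (simp add: a b algebra_simps)
  then have "Im (a * cnj b) / Im \<tau> = of_int (m * l - n * k)" using assms by simp
  then show ?thesis by (metis Ints_of_int)
qed

lemma H_tau_positive_definite:
  assumes "Im \<tau> > 0"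
  shows "positive_definite (H_tau \<tau>)"
  unfolding positive_definite_def
proof (intro allI impI)
  fix z :: "complex ^ 2" assume "z \<noteq> 0"
  have e: "H_tau \<tau> z z = of_real (((norm (z $ 1))\<^sup>2 + (norm (z $ 2))\<^sup>2) / Im \<tau>)"
    by (simp only: H_tau_def of_real_divide of_real_add complex_norm_square) simp
  have "(norm (z $ 1))\<^sup>2 + (norm (z $ 2))\<^sup>2 > 0"
    using \<open>z \<noteq> 0\<close> by (auto simp: vec2_eq_iff sum_power2_gt_zero_iff)
  then show "H_tau \<tau> z z \<in> \<real> \<and> Re (H_tau \<tau> z z) > 0"
    unfolding e using assms by simp
qed

lemma H_tau_riemann_form:
  assumes "Im \<tau> > 0"
  shows "riemann_form (L_tau \<tau>) (H_tau \<tau>)"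
  unfolding riemann_form_def
proof (intro conjI ballI)
  show "hermitian_form (H_tau \<tau>)"
    unfolding hermitian_form_def H_tau_def by (auto simp: algebra_simps)
  show "nondegenerate (H_tau \<tau>)"
    unfolding nondegenerate_def
    using H_tau_positive_definite[OF assms] unfolding positive_definite_def by force
  show "Im (H_tau \<tau> \<alpha> \<beta>) \<in> \<int>" if "\<alpha> \<in> L_tau \<tau>" "\<beta> \<in> L_tau \<tau>" for \<alpha> \<beta>
  proof -
    have "Im (\<alpha> $ 1 * cnj (\<beta> $ 1)) / Im \<tau> + Im (\<alpha> $ 2 * cnj (\<beta> $ 2)) / Im \<tau> \<in> \<int>"
      using that assms by (intro Ints_add Im_lattice1_form) (auto simp: L_tau_eq)
    moreover have "H_tau \<tau> \<alpha> \<beta> = (\<alpha> $ 1 * cnj (\<beta> $ 1) + \<alpha> $ 2 * cnj (\<beta> $ 2)) / of_real (Im \<tau>)"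
      by (simp add: H_tau_def)
    ultimately show ?thesis by (simp only: Im_divide_of_real add_divide_distrib plus_complex.sel)
  qed
qed

text \<open>
  The two sides differ by the defect \<open>exp h\<close> of the semi-character and by the asymmetry of \<open>H\<close>, which
  contributes the same \<open>exp h\<close> once more; integrality of \<open>Im H\<close> gives \<open>(exp h)\<^sup>2 = 1\<close>.
\<close>

lemma automorphy_factor_cocycle:
  assumes R: "riemann_form L H" and ch: "semi_character L (\<lambda>z w. Im (H z w)) ch"
    and L: "\<alpha> \<in> L" "\<beta> \<in> L"
  shows "automorphy_factor H ch (\<alpha> + \<beta>) z =
    automorphy_factor H ch \<alpha> (z + \<beta>) * automorphy_factor H ch \<beta> z"
proof -
  have add1: "H (x + y) w = H x w + H y w" and cnj: "H w x = cnj (H x w)" for x y w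
    using R unfolding riemann_form_def hermitian_form_def by blast+
  have add2: "H w (x + y) = H w x + H w y" for x y w
    by (metis add1 cnj complex_cnj_add)
  obtain k where k: "Im (H \<alpha> \<beta>) = of_int k"
    using R L unfolding riemann_form_def by (metis Ints_cases)
  define h where "h = \<i> * of_real pi * of_real (Im (H \<alpha> \<beta>))"
  have sym: "of_real pi / 2 * H \<beta> \<alpha> = of_real pi / 2 * H \<alpha> \<beta> - h"
    unfolding cnj[of \<beta> \<alpha>] h_def by (simp add: complex_eq_iff)
  have "exp (h + h) = 1"
    unfolding exp_eq_1 by (auto simp: h_def k intro!: exI[of _ k])
  then have hh: "exp h * exp h = 1" by (simp only: exp_add)
  have "ch (\<alpha> + \<beta>) = ch \<alpha> * ch \<beta> * exp h"
    using ch L unfolding semi_character_def h_def by blast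
  moreover have "of_real pi * H z (\<alpha> + \<beta>) + of_real pi / 2 * H (\<alpha> + \<beta>) (\<alpha> + \<beta>) =
      (of_real pi * H (z + \<beta>) \<alpha> + of_real pi / 2 * H \<alpha> \<alpha>) +
      (of_real pi * H z \<beta> + of_real pi / 2 * H \<beta> \<beta>) + (of_real pi / 2 * H \<alpha> \<beta> - of_real pi / 2 * H \<beta> \<alpha>)"
    by (simp add: add1 add2 algebra_simps)
  moreover have "of_real pi / 2 * H \<alpha> \<beta> - of_real pi / 2 * H \<beta> \<alpha> = h" unfolding sym by simp
  ultimately show ?thesis
    using hh unfolding automorphy_factor_def by (simp add: exp_add)
qed

lemma automorphy_factor_0:
  assumes R: "riemann_form L H" and ch: "semi_character L (\<lambda>z w. Im (H z w)) ch" and L: "0 \<in> L"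
  shows "automorphy_factor H ch 0 z = 1"
proof -
  have "H (z + z') w = H z w + H z' w" and cnj: "H w z = cnj (H z w)" for z z' w
    using R unfolding riemann_form_def hermitian_form_def by blast+
  from this(1)[of 0 0] have H0: "H 0 w = 0" for w by simp
  have H0': "H w 0 = 0" for w using cnj[of w 0] by (simp add: H0)
  have "norm (ch 0) = 1" "ch (0 + 0) = ch 0 * ch 0 * exp (\<i> * of_real pi * of_real (Im (H 0 0)))"
    using ch L unfolding semi_character_def by blast+
  then have "ch 0 = 1" by (auto simp: H0)
  then show ?thesis by (simp add: automorphy_factor_def H0 H0')
qed

section \<open>Sections in terms of theta functions of one variable\<close>

definition sections_power :: "complex \<Rightarrow> (complex ^ 2 \<Rightarrow> complex) \<Rightarrow> nat \<Rightarrow> (complex ^ 2 \<Rightarrow> complex) set" where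
  "sections_power \<tau> ch n = {\<theta>. entire2 \<theta> \<and>
     (\<forall>\<alpha>\<in>L_tau \<tau>. \<forall>z. \<theta> (z + \<alpha>) = automorphy_factor (H_tau \<tau>) ch \<alpha> z ^ n * \<theta> z)}"

text \<open>
  For a value \<open>c\<close> of the semi-character at a generator \<open>1\<close> or \<open>\<tau>\<close> of one of the two summands, the constant
  part of the automorphy factor there; the rest is the exponential of a linear function, as in
  \<open>theta_space\<close>.
\<close>

definition multiplier_one :: "complex \<Rightarrow> complex \<Rightarrow> complex" where
  "multiplier_one \<tau> c = c * exp (kappa \<tau> / 2)"

definition multiplier_tau :: "complex \<Rightarrow> complex \<Rightarrow> complex" where
  "multiplier_tau \<tau> c = c * exp (kappa \<tau> * (\<tau> * cnj \<tau>) / 2)"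

context
  fixes \<tau> :: complex and ch :: "complex ^ 2 \<Rightarrow> complex"
  assumes \<tau>: "Im \<tau> > 0"
    and ch: "semi_character (L_tau \<tau>) (\<lambda>z w. Im (H_tau \<tau> z w)) ch"
begin

lemmas L_add = additive_subgroup.add[OF additive_subgroup_L_tau[of \<tau>]]
lemmas L_uminus = additive_subgroup.uminus[OF additive_subgroup_L_tau[of \<tau>]]
lemmas L_zero = additive_subgroup.zero[OF additive_subgroup_L_tau[of \<tau>]]

abbreviation (input) "J \<equiv> automorphy_factor (H_tau \<tau>) ch"

lemma J_cocycle:
  "\<alpha> \<in> L_tau \<tau> \<Longrightarrow> \<beta> \<in> L_tau \<tau> \<Longrightarrow> J (\<alpha> + \<beta>) z = J \<alpha> (z + \<beta>) * J \<beta> z"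
  by (rule automorphy_factor_cocycle[OF H_tau_riemann_form[OF \<tau>] ch])

lemma J_0: "J 0 z = 1"
  by (rule automorphy_factor_0[OF H_tau_riemann_form[OF \<tau>] ch L_zero])

lemma ch_nonzero: "\<alpha> \<in> L_tau \<tau> \<Longrightarrow> ch \<alpha> \<noteq> 0"
  using ch unfolding semi_character_def by fastforce

lemma J_nonzero: "\<alpha> \<in> L_tau \<tau> \<Longrightarrow> J \<alpha> z \<noteq> 0"
  by (simp add: automorphy_factor_def ch_nonzero)

lemma global_sections_tensor_power:
  "global_sections (L_tau \<tau>) (tensor_power (line_bundle (L_tau \<tau>) (H_tau \<tau>) ch) n) = sections_power \<tau> ch n"
  unfolding line_bundle_def tensor_power_quotient_bundle sections_power_def
  by (rule global_sections_quotient_bundle)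
    (simp_all add: L_zero L_add L_uminus J_0 J_cocycle power_mult_distrib)

lemma global_sections_line_bundle_tau:
  "global_sections (L_tau \<tau>) (line_bundle (L_tau \<tau>) (H_tau \<tau>) ch) = sections_power \<tau> ch 1"
  using global_sections_line_bundle[OF H_tau_riemann_form[OF \<tau>] ch L_zero L_add L_uminus]
  by (simp add: sections_power_def)

lemma J_generators:
  "J (pair_vec 1 0) z ^ n = multiplier_one \<tau> (ch (pair_vec 1 0)) ^ n * exp (of_nat n * kappa \<tau> * z $ 1)"
  "J (pair_vec \<tau> 0) z ^ n = multiplier_tau \<tau> (ch (pair_vec \<tau> 0)) ^ n * exp (of_nat n * kappa \<tau> * cnj \<tau> * z $ 1)"
  "J (pair_vec 0 1) z ^ n = multiplier_one \<tau> (ch (pair_vec 0 1)) ^ n * exp (of_nat n * kappa \<tau> * z $ 2)"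
  "J (pair_vec 0 \<tau>) z ^ n = multiplier_tau \<tau> (ch (pair_vec 0 \<tau>)) ^ n * exp (of_nat n * kappa \<tau> * cnj \<tau> * z $ 2)"
proof -
  have H1: "of_real pi * H_tau \<tau> z (pair_vec a 0) = kappa \<tau> * cnj a * z $ 1"
    and H2: "of_real pi * H_tau \<tau> z (pair_vec 0 a) = kappa \<tau> * cnj a * z $ 2" for z a
    by (simp_all add: H_tau_def kappa_def)
  have H1': "of_real pi / 2 * H_tau \<tau> z (pair_vec a 0) = kappa \<tau> * cnj a * z $ 1 / 2"
    and H2': "of_real pi / 2 * H_tau \<tau> z (pair_vec 0 a) = kappa \<tau> * cnj a * z $ 2 / 2" for z a
    using H1[of z a] H2[of z a] by simp_all
  have e: "exp (of_nat n * kappa \<tau> * x) = exp (kappa \<tau> * x) ^ n"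
    "exp (of_nat n * kappa \<tau> * cnj \<tau> * x) = exp (kappa \<tau> * cnj \<tau> * x) ^ n" for x
    by (simp_all only: mult.assoc exp_of_nat_mult)
  show "J (pair_vec 1 0) z ^ n = multiplier_one \<tau> (ch (pair_vec 1 0)) ^ n * exp (of_nat n * kappa \<tau> * z $ 1)"
    "J (pair_vec \<tau> 0) z ^ n = multiplier_tau \<tau> (ch (pair_vec \<tau> 0)) ^ n * exp (of_nat n * kappa \<tau> * cnj \<tau> * z $ 1)"
    "J (pair_vec 0 1) z ^ n = multiplier_one \<tau> (ch (pair_vec 0 1)) ^ n * exp (of_nat n * kappa \<tau> * z $ 2)"
    "J (pair_vec 0 \<tau>) z ^ n = multiplier_tau \<tau> (ch (pair_vec 0 \<tau>)) ^ n * exp (of_nat n * kappa \<tau> * cnj \<tau> * z $ 2)"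
    unfolding e automorphy_factor_def H1 H2 H1' H2' multiplier_one_def multiplier_tau_def
      power_mult_distrib[symmetric]
    by (simp_all add: exp_add mult_ac)
qed

abbreviation "A1 \<equiv> multiplier_one \<tau> (ch (pair_vec 1 0))"
abbreviation "C1 \<equiv> multiplier_tau \<tau> (ch (pair_vec \<tau> 0))"
abbreviation "A2 \<equiv> multiplier_one \<tau> (ch (pair_vec 0 1))"
abbreviation "C2 \<equiv> multiplier_tau \<tau> (ch (pair_vec 0 \<tau>))"

lemma multipliers_nonzero: "A1 \<noteq> 0" "C1 \<noteq> 0" "A2 \<noteq> 0" "C2 \<noteq> 0"
  by (simp_all add: multiplier_one_def multiplier_tau_def ch_nonzero pair_vec_in_L_tau
      zero_in_lattice1 one_in_lattice1 tau_in_lattice1)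

text \<open>
  By the cocycle relation the periods for which the functional equation holds form a group, so the
  four generators suffice.
\<close>

lemma sections_power_iff_generators:
  "f \<in> sections_power \<tau> ch n \<longleftrightarrow> entire2 f \<and>
    (\<forall>\<alpha>\<in>{pair_vec 1 0, pair_vec \<tau> 0, pair_vec 0 1, pair_vec 0 \<tau>}. \<forall>z. f (z + \<alpha>) = J \<alpha> z ^ n * f z)"
    (is "_ \<longleftrightarrow> _ \<and> (\<forall>\<alpha>\<in>?G. _)")
proof
  have "?G \<subseteq> L_tau \<tau>"
    by (simp add: pair_vec_in_L_tau zero_in_lattice1 one_in_lattice1 tau_in_lattice1)
  then show "f \<in> sections_power \<tau> ch n \<Longrightarrow> entire2 f \<and> (\<forall>\<alpha>\<in>?G. \<forall>z. f (z + \<alpha>) = J \<alpha> z ^ n * f z)"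
    unfolding sections_power_def by blast
next
  assume *: "entire2 f \<and> (\<forall>\<alpha>\<in>?G. \<forall>z. f (z + \<alpha>) = J \<alpha> z ^ n * f z)"
  define P where "P \<alpha> \<longleftrightarrow> \<alpha> \<in> L_tau \<tau> \<and> (\<forall>z. f (z + \<alpha>) = J \<alpha> z ^ n * f z)" for \<alpha>
  have P0: "P 0" by (simp add: P_def L_zero J_0)
  have Padd: "P (\<alpha> + \<beta>)" if "P \<alpha>" "P \<beta>" for \<alpha> \<beta>
    unfolding P_def
  proof (intro conjI allI)
    fix z
    have "f (z + (\<alpha> + \<beta>)) = f ((z + \<beta>) + \<alpha>)" by (simp add: add_ac)
    also have "\<dots> = J \<alpha> (z + \<beta>) ^ n * (J \<beta> z ^ n * f z)" using that by (simp add: P_def)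
    also have "\<dots> = J (\<alpha> + \<beta>) z ^ n * f z"
      using that J_cocycle[of \<alpha> \<beta> z] by (simp add: P_def power_mult_distrib)
    finally show "f (z + (\<alpha> + \<beta>)) = J (\<alpha> + \<beta>) z ^ n * f z" .
  qed (use that L_add in \<open>auto simp: P_def\<close>)
  have Pminus: "P (- \<alpha>)" if "P \<alpha>" for \<alpha>
    unfolding P_def
  proof (intro conjI allI)
    show L: "- \<alpha> \<in> L_tau \<tau>" using that L_uminus by (simp add: P_def)
    fix z
    have "J \<alpha> (z + - \<alpha>) * J (- \<alpha>) z = 1"
      using J_cocycle[of \<alpha> "- \<alpha>" z] that L by (simp add: P_def J_0)
    then have 1: "J (- \<alpha>) z ^ n * J \<alpha> (z + - \<alpha>) ^ n = 1"
      by (simp add: mult.commute flip: power_mult_distrib)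
    have "f z = J \<alpha> (z + - \<alpha>) ^ n * f (z + - \<alpha>)"
    proof -
      have "f ((z + - \<alpha>) + \<alpha>) = J \<alpha> (z + - \<alpha>) ^ n * f (z + - \<alpha>)"
        using that unfolding P_def by blast
      then show ?thesis by simp
    qed
    then have "J (- \<alpha>) z ^ n * f z = (J (- \<alpha>) z ^ n * J \<alpha> (z + - \<alpha>) ^ n) * f (z + - \<alpha>)"
      by (simp only: mult.assoc)
    then show "f (z + - \<alpha>) = J (- \<alpha>) z ^ n * f z" unfolding 1 by simp
  qed
  have PG: "P \<alpha>" if "\<alpha> \<in> ?G" for \<alpha>
    using * that by (auto simp: P_def pair_vec_in_L_tau zero_in_lattice1 one_in_lattice1 tau_in_lattice1)
  have z0: "pair_vec 0 0 = 0" by (simp add: vec2_eq_iff)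
  have P1: "P (pair_vec l 0)" if "l \<in> lattice1 \<tau>" for l
    using that
  proof (induction rule: lattice1_induct)
    case (add x y)
    then show ?case using Padd[OF add] by (simp add: pair_vec_add)
  next
    case (uminus x)
    have "- pair_vec x 0 = pair_vec (- x) 0" by (simp add: vec2_eq_iff)
    then show ?case using Pminus[OF uminus] by simp
  qed (use PG P0 z0 in auto)
  have P2: "P (pair_vec 0 l)" if "l \<in> lattice1 \<tau>" for l
    using that
  proof (induction rule: lattice1_induct)
    case (add x y)
    then show ?case using Padd[OF add] by (simp add: pair_vec_add)
  next
    case (uminus x)
    have "- pair_vec 0 x = pair_vec 0 (- x)" by (simp add: vec2_eq_iff)
    then show ?case using Pminus[OF uminus] by simp
  qed (use PG P0 z0 in auto)
  have "P \<alpha>" if "\<alpha> \<in> L_tau \<tau>" for \<alpha>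
  proof -
    have "P (pair_vec (\<alpha> $ 1) 0 + pair_vec 0 (\<alpha> $ 2))"
      using that by (intro Padd P1 P2) (auto simp: L_tau_eq)
    then show ?thesis by (simp add: pair_vec_add)
  qed
  then show "f \<in> sections_power \<tau> ch n" using * unfolding sections_power_def P_def by blast
qed

lemma sections_power_slices:
  assumes "f \<in> sections_power \<tau> ch n"
  shows "(\<lambda>a. f (pair_vec a b)) \<in> theta_space \<tau> n (A1 ^ n) (C1 ^ n)"
    and "(\<lambda>b. f (pair_vec a b)) \<in> theta_space \<tau> n (A2 ^ n) (C2 ^ n)"
proof -
  have ent: "entire2 f" and gen: "\<And>\<alpha> z. \<alpha> \<in> {pair_vec 1 0, pair_vec \<tau> 0, pair_vec 0 1, pair_vec 0 \<tau>} \<Longrightarrow>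
      f (z + \<alpha>) = J \<alpha> z ^ n * f z"
    using assms unfolding sections_power_iff_generators by blast+
  show "(\<lambda>a. f (pair_vec a b)) \<in> theta_space \<tau> n (A1 ^ n) (C1 ^ n)"
    unfolding theta_space_def
    using holomorphic_slices(1)[OF ent] gen[of "pair_vec 1 0" "pair_vec _ b"] gen[of "pair_vec \<tau> 0" "pair_vec _ b"]
    by (simp add: J_generators pair_vec_add)
  show "(\<lambda>b. f (pair_vec a b)) \<in> theta_space \<tau> n (A2 ^ n) (C2 ^ n)"
    unfolding theta_space_def
    using holomorphic_slices(2)[OF ent] gen[of "pair_vec 0 1" "pair_vec a _"] gen[of "pair_vec 0 \<tau>" "pair_vec a _"]
    by (simp add: J_generators pair_vec_add)
qed

lemma split_product_in_sections_power:
  assumes f: "f \<in> theta_space \<tau> n (A1 ^ n) (C1 ^ n)" and g: "g \<in> theta_space \<tau> n (A2 ^ n) (C2 ^ n)"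
  shows "(\<lambda>z. f (z $ 1) * g (z $ 2)) \<in> sections_power \<tau> ch n"
  unfolding sections_power_iff_generators
  using entire2_split_product[OF theta_space_holomorphic[OF f] theta_space_holomorphic[OF g]]
  by (auto simp: J_generators theta_space_one[OF f] theta_space_tau[OF f]
      theta_space_one[OF g] theta_space_tau[OF g])

lemma subspace_sections_power: "cfun.subspace (sections_power \<tau> ch n)"
proof (rule cfun.subspaceI)
  have "entire2 (\<lambda>_. 0)"
    using entire2_split_product[of "\<lambda>_. 0" "\<lambda>_. 0"] by simp
  then show "0 \<in> sections_power \<tau> ch n" by (simp add: sections_power_def zero_fun_def)
  show "f + g \<in> sections_power \<tau> ch n" if "f \<in> sections_power \<tau> ch n" "g \<in> sections_power \<tau> ch n" for f g
    using that entire2_add[of f g] by (auto simp: sections_power_def plus_fun_def algebra_simps)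
  show "(\<lambda>z. c * f z) \<in> sections_power \<tau> ch n" if "f \<in> sections_power \<tau> ch n" for f c
    using that entire2_scale[of f c] by (auto simp: sections_power_def algebra_simps)
qed

text \<open>
  If \<open>P\<close> determines theta functions of degree \<open>n\<close> in one variable, then \<open>P \<times> P\<close> determines sections: one
  that vanishes there vanishes on every slice through \<open>P\<close> in one direction, hence on every slice in
  the other direction.
\<close>

lemma sections_power_basis: "\<exists>bs. is_basis (sections_power \<tau> ch n) bs"
proof -
  obtain P where fin: "finite P" and P': "\<forall>f A C. f \<in> theta_space \<tau> n A C \<longrightarrow> A \<noteq> 0 \<longrightarrow> C \<noteq> 0 \<longrightarrow>
      (\<forall>p\<in>P. f p = 0) \<longrightarrow> (\<forall>z. f z = 0)"
    using theta_space_determining_points[OF \<tau>, of n] by blast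
  have P: "f z = 0"
    if "f \<in> theta_space \<tau> n A C" "A \<noteq> 0" "C \<noteq> 0" "\<And>p. p \<in> P \<Longrightarrow> f p = 0" for f A C z
    using P' that by blast
  let ?P = "(\<lambda>(a, b). pair_vec a b) ` (P \<times> P)"
  show ?thesis
  proof (rule basis_of_determining_points[OF _ subspace_sections_power])
    show "finite ?P" using fin by simp
    fix f assume f: "f \<in> sections_power \<tau> ch n" and zero: "\<And>p. p \<in> ?P \<Longrightarrow> f p = 0"
    have 1: "f (pair_vec a b) = 0" if "b \<in> P" for a b
      by (rule P[OF sections_power_slices(1)[OF f, of b]]) (use multipliers_nonzero zero that in auto)
    have "f (pair_vec a b) = 0" for a b
      by (rule P[OF sections_power_slices(2)[OF f, of a]]) (use multipliers_nonzero 1 in auto)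
    then have "f z = 0" for z by (metis pair_vec_eta)
    then show "f = 0" by (simp add: fun_eq_iff)
  qed
qed

text \<open>
  By uniqueness in one variable, each slice in the first direction is a multiple of \<open>\<theta>\<^sub>1\<close>. The factor, as a
  function of the other variable, is up to a constant a slice in the second direction, hence a
  multiple of \<open>\<theta>\<^sub>2\<close>.
\<close>

lemma dim_sections_power_1: "cfun.dim (sections_power \<tau> ch 1) = 1"
proof -
  obtain \<theta>1 a where 1: "\<theta>1 \<in> theta_space \<tau> 1 A1 C1" "\<And>z. \<theta>1 z = 0 \<longleftrightarrow> z - a \<in> lattice1 \<tau>"
    "\<And>z. \<theta>1 z = 0 \<Longrightarrow> deriv \<theta>1 z \<noteq> 0"
    using theta_space_1_exists[OF \<tau> multipliers_nonzero(1,2)] by blast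
  obtain \<theta>2 b where 2: "\<theta>2 \<in> theta_space \<tau> 1 A2 C2" "\<And>z. \<theta>2 z = 0 \<longleftrightarrow> z - b \<in> lattice1 \<tau>"
    "\<And>z. \<theta>2 z = 0 \<Longrightarrow> deriv \<theta>2 z \<noteq> 0"
    using theta_space_1_exists[OF \<tau> multipliers_nonzero(3,4)] by blast
  define \<theta> where "\<theta> z = \<theta>1 (z $ 1) * \<theta>2 (z $ 2)" for z :: "complex ^ 2"
  have \<theta>: "\<theta> \<in> sections_power \<tau> ch 1"
    using split_product_in_sections_power[of \<theta>1 1 \<theta>2] 1 2 by (simp add: \<theta>_def[abs_def])
  define p where "p = a + 1 / 2"
  define q where "q = b + 1 / 2"
  have p: "\<theta>1 p \<noteq> 0" and q: "\<theta>2 q \<noteq> 0"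
    using half_not_in_lattice1[OF \<tau>] by (simp_all add: 1 2 p_def q_def)
  have "f \<in> cfun.span {\<theta>}" if f: "f \<in> sections_power \<tau> ch 1" for f
  proof -
    have "\<exists>c. \<forall>x. f (pair_vec x y) = c * \<theta>1 x" for y
      using theta_space_1_unique[OF \<tau> multipliers_nonzero(1,2) _ 1] sections_power_slices(1)[OF f, of y]
      by (metis power_one_right)
    then obtain c where c: "\<And>x y. f (pair_vec x y) = c y * \<theta>1 x" by metis
    obtain d where d: "\<And>y. f (pair_vec p y) = d * \<theta>2 y"
      using theta_space_1_unique[OF \<tau> multipliers_nonzero(3,4) _ 2] sections_power_slices(2)[OF f, of p]
      by (metis power_one_right)
    have "c y = d / \<theta>1 p * \<theta>2 y" for y
      using c[of p y] d[of y] p by (simp add: field_simps)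
    then have "f z = d / \<theta>1 p * \<theta> z" for z
      using c[of "z $ 1" "z $ 2"] by (simp add: \<theta>_def)
    then have "f = (\<lambda>z. d / \<theta>1 p * \<theta> z)" by auto
    then show ?thesis by (metis cfun.span_base cfun.span_scale singletonI)
  qed
  moreover have "cfun.span {\<theta>} \<subseteq> sections_power \<tau> ch 1"
    using \<theta> by (intro cfun.span_minimal subspace_sections_power) auto
  ultimately have "cfun.span {\<theta>} = cfun.span (sections_power \<tau> ch 1)"
    using cfun.span_eq_iff[THEN iffD2, OF subspace_sections_power] by blast
  moreover have "\<theta> (pair_vec p q) \<noteq> 0" using p q by (simp add: \<theta>_def)
  then have "\<theta> \<noteq> 0" by auto
  then have "cfun.independent {\<theta>}" by (simp add: cfun.dependent_single)
  ultimately show ?thesis using cfun.dim_eq_card by fastforce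
qed

section \<open>Separation of points and tangent vectors\<close>

text \<open>
  Two incongruent points differ in some coordinate; a separating function of this coordinate is
  multiplied by a function of the other coordinate that does not vanish.
\<close>

lemma sections_power_points:
  assumes n: "n \<ge> 3" and zw: "w - z \<notin> L_tau \<tau>"
  shows "\<exists>f\<in>sections_power \<tau> ch n. f z = 0 \<and> f w \<noteq> 0"
proof -
  consider "w $ 1 - z $ 1 \<notin> lattice1 \<tau>" | "w $ 2 - z $ 2 \<notin> lattice1 \<tau>"
    using zw by (auto simp: L_tau_eq)
  then show ?thesis
  proof cases
    case 1
    obtain f where f: "f \<in> theta_space \<tau> n (A1 ^ n) (C1 ^ n)" "f (z $ 1) = 0" "f (w $ 1) \<noteq> 0"
      using theta_space_separation[OF \<tau> multipliers_nonzero(1,2) n, of "{w $ 1}" "z $ 1"] 1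
      by (metis finite.emptyI finite.insertI singletonI)
    obtain g where g: "g \<in> theta_space \<tau> n (A2 ^ n) (C2 ^ n)" "g (w $ 2) \<noteq> 0"
      using theta_space_nonvanishing[OF \<tau> multipliers_nonzero(3,4) n, of "{w $ 2}"]
      by (metis finite.emptyI finite.insertI singletonI)
    show ?thesis
      by (rule bexI[OF _ split_product_in_sections_power[OF f(1) g(1)]]) (simp add: f g)
  next
    case 2
    obtain f where f: "f \<in> theta_space \<tau> n (A1 ^ n) (C1 ^ n)" "f (w $ 1) \<noteq> 0"
      using theta_space_nonvanishing[OF \<tau> multipliers_nonzero(1,2) n, of "{w $ 1}"]
      by (metis finite.emptyI finite.insertI singletonI)
    obtain g where g: "g \<in> theta_space \<tau> n (A2 ^ n) (C2 ^ n)" "g (z $ 2) = 0" "g (w $ 2) \<noteq> 0"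
      using theta_space_separation[OF \<tau> multipliers_nonzero(3,4) n, of "{w $ 2}" "z $ 2"] 2
      by (metis finite.emptyI finite.insertI singletonI)
    show ?thesis
      by (rule bexI[OF _ split_product_in_sections_power[OF f(1) g(1)]]) (simp add: f g)
  qed
qed

lemma sections_power_nonvanishing:
  assumes n: "n \<ge> 3"
  shows "\<exists>f\<in>sections_power \<tau> ch n. f z \<noteq> 0"
proof -
  obtain f where f: "f \<in> theta_space \<tau> n (A1 ^ n) (C1 ^ n)" "f (z $ 1) \<noteq> 0"
    using theta_space_nonvanishing[OF \<tau> multipliers_nonzero(1,2) n, of "{z $ 1}"]
    by (metis finite.emptyI finite.insertI singletonI)
  obtain g where g: "g \<in> theta_space \<tau> n (A2 ^ n) (C2 ^ n)" "g (z $ 2) \<noteq> 0"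
    using theta_space_nonvanishing[OF \<tau> multipliers_nonzero(3,4) n, of "{z $ 2}"]
    by (metis finite.emptyI finite.insertI singletonI)
  show ?thesis
    by (rule bexI[OF _ split_product_in_sections_power[OF f(1) g(1)]]) (simp add: f g)
qed

text \<open>
  If the first coordinate of \<open>v\<close> is nonzero, take \<open>f\<close> with a simple zero at \<open>z $ 1\<close> and \<open>g\<close> nonzero at \<open>z $ 2\<close>: the
  derivative of the product along \<open>v\<close> is \<open>deriv f (z $ 1) * v $ 1 * g (z $ 2)\<close>.
\<close>

lemma sections_power_tangents:
  assumes n: "n \<ge> 3" and v: "v \<noteq> 0"
  shows "\<exists>f\<in>sections_power \<tau> ch n. f z = 0 \<and> (\<exists>D. has_complex_derivative f D z \<and> D v \<noteq> 0)"
proof -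
  consider "v $ 1 \<noteq> 0" | "v $ 2 \<noteq> 0" using v by (auto simp: vec2_eq_iff)
  then show ?thesis
  proof cases
    case 1
    obtain f where f: "f \<in> theta_space \<tau> n (A1 ^ n) (C1 ^ n)" "f (z $ 1) = 0" "deriv f (z $ 1) \<noteq> 0"
      using theta_space_separation[OF \<tau> multipliers_nonzero(1,2) n, of "{}" "z $ 1"]
      by (metis finite.emptyI)
    obtain g where g: "g \<in> theta_space \<tau> n (A2 ^ n) (C2 ^ n)" "g (z $ 2) \<noteq> 0"
      using theta_space_nonvanishing[OF \<tau> multipliers_nonzero(3,4) n, of "{z $ 2}"]
      by (metis finite.emptyI finite.insertI singletonI)
    note D = has_complex_derivative_split_product[OF theta_space_holomorphic[OF f(1)]
        theta_space_holomorphic[OF g(1)], of z]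
    have "\<exists>D. has_complex_derivative (\<lambda>z. f (z $ 1) * g (z $ 2)) D z \<and> D v \<noteq> 0"
      by (rule exI, rule conjI, rule D) (simp add: f g 1)
    then show ?thesis
      by (intro bexI[OF _ split_product_in_sections_power[OF f(1) g(1)]]) (simp add: f g)
  next
    case 2
    obtain f where f: "f \<in> theta_space \<tau> n (A1 ^ n) (C1 ^ n)" "f (z $ 1) \<noteq> 0"
      using theta_space_nonvanishing[OF \<tau> multipliers_nonzero(1,2) n, of "{z $ 1}"]
      by (metis finite.emptyI finite.insertI singletonI)
    obtain g where g: "g \<in> theta_space \<tau> n (A2 ^ n) (C2 ^ n)" "g (z $ 2) = 0" "deriv g (z $ 2) \<noteq> 0"
      using theta_space_separation[OF \<tau> multipliers_nonzero(3,4) n, of "{}" "z $ 2"]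
      by (metis finite.emptyI)
    note D = has_complex_derivative_split_product[OF theta_space_holomorphic[OF f(1)]
        theta_space_holomorphic[OF g(1)], of z]
    have "\<exists>D. has_complex_derivative (\<lambda>z. f (z $ 1) * g (z $ 2)) D z \<and> D v \<noteq> 0"
      by (rule exI, rule conjI, rule D) (simp add: f g 2)
    then show ?thesis
      by (intro bexI[OF _ split_product_in_sections_power[OF f(1) g(1)]]) (simp add: f g)
  qed
qed

lemma sections_give_embedding_tau:
  assumes n: "n \<ge> 3"
  shows "sections_give_embedding (L_tau \<tau>) (tensor_power (line_bundle (L_tau \<tau>) (H_tau \<tau>) ch) n)"
  unfolding sections_give_embedding_def global_sections_tensor_power
proof (intro conjI allI impI)
  show "\<exists>bs. is_basis (sections_power \<tau> ch n) bs" by (rule sections_power_basis)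
next
  fix bs assume "is_basis (sections_power \<tau> ch n) bs"
  then have V: "cfun.span (set bs) = sections_power \<tau> ch n" by (simp add: is_basis_def)
  show "\<exists>\<phi>. (\<forall>z. eval_list bs z \<noteq> (\<lambda>_. 0) \<and> \<phi> (torus_proj (L_tau \<tau>) z) = proj_class (eval_list bs z)) \<and>
      closed_holomorphic_embedding (L_tau \<tau>) (length bs) \<phi>"
  proof (rule additive_subgroup.separating_sections_embed[OF additive_subgroup_L_tau
        compact_torus_tau[OF \<tau>], of bs "\<lambda>\<alpha> z. J \<alpha> z ^ n", unfolded V])
    show "entire2 f" if "f \<in> sections_power \<tau> ch n" for f
      using that by (simp add: sections_power_def)
    show "J \<alpha> z ^ n \<noteq> 0" if "\<alpha> \<in> L_tau \<tau>" for \<alpha> z using J_nonzero[OF that] by simp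
    show "f (z + \<alpha>) = J \<alpha> z ^ n * f z" if "f \<in> sections_power \<tau> ch n" "\<alpha> \<in> L_tau \<tau>" for f \<alpha> z
      using that by (simp add: sections_power_def)
  qed (fact sections_power_nonvanishing[OF n] sections_power_points[OF n] sections_power_tangents[OF n])+
qed

end

theorem theorem3p3:
  fixes \<tau> :: complex and ch :: "complex ^ 2 \<Rightarrow> complex"
  assumes "Im \<tau> > 0"
    and "semi_character (L_tau \<tau>) (\<lambda>z w. Im (H_tau \<tau> z w)) ch"
  shows "(riemann_form (L_tau \<tau>) (H_tau \<tau>) \<and> positive_definite (H_tau \<tau>)) \<and>
    (ample (L_tau \<tau>) (line_bundle (L_tau \<tau>) (H_tau \<tau>) ch) \<and>
     (\<forall>n\<ge>3. sections_give_embedding (L_tau \<tau>)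
        (tensor_power (line_bundle (L_tau \<tau>) (H_tau \<tau>) ch) n))) \<and>
    cfun.dim (global_sections (L_tau \<tau>) (line_bundle (L_tau \<tau>) (H_tau \<tau>) ch)) = 1"
proof (intro conjI allI impI)
  show "riemann_form (L_tau \<tau>) (H_tau \<tau>)" by (rule H_tau_riemann_form[OF assms(1)])
  show "positive_definite (H_tau \<tau>)" by (rule H_tau_positive_definite[OF assms(1)])
  show "ample (L_tau \<tau>) (line_bundle (L_tau \<tau>) (H_tau \<tau>) ch)"
    unfolding ample_def by (intro exI[of _ 3] conjI sections_give_embedding_tau[OF assms]) simp_all
  show "sections_give_embedding (L_tau \<tau>) (tensor_power (line_bundle (L_tau \<tau>) (H_tau \<tau>) ch) n)"
    if "n \<ge> 3" for n by (rule sections_give_embedding_tau[OF assms that])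
  show "cfun.dim (global_sections (L_tau \<tau>) (line_bundle (L_tau \<tau>) (H_tau \<tau>) ch)) = 1"
    unfolding global_sections_line_bundle_tau[OF assms] by (rule dim_sections_power_1[OF assms])
qed

end
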